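(* Let $n\ge2$ and let $X_i=(W_i,R_i)$, $i=1,\dots,n$, be mutually independent random pairs with values in $(0,\infty)\times[0,1]$ (within each pair, $W_i$ and $R_i$ may be dependent). Let $S=(X_1,\dots,X_n)$ and \[ f^{\mathrm{wa}}(S)=\frac{\sum_{i=1}^nW_iR_i}{\sum_{j=1}^nW_j}. \] For each $k$ let $W_k'$ have the same distribution as $W_k$ and be independent of $(X_1,\dots,X_n)$, and set \[ \tilde W_k=\frac{W_k}{\sum_{j=1}^nW_j},\qquad \tilde U_k=\frac{W_k'}{W_k'+\sum_{j\ne k}W_j},\qquad V^{\mathrm{wa}}=\sum_{k=1}^n\mathbb{E}\big[\tilde W_k^2+\tilde U_k^2\,\big|\,W_1,\dots,W_k\big]. \] Then for every $y>0$ and $x\ge2$, with probability at least $1-e^{-x}$, \[ \big|f^{\mathrm{wa}}(S)-\mathbb{E}[f^{\mathrm{wa}}(S)]\big|\le\sqrt{2\,(2V^{\mathrm{wa}}+y)\Big(1+\ln\sqrt{1+2V^{\mathrm{wa}}/y}\Big)x}. \] *)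

theory Defs
  imports "HOL-Probability.Probability"
begin

definition gen_sigma :: "'a measure \<Rightarrow> (nat \<Rightarrow> 'a \<Rightarrow> real) \<Rightarrow> nat set \<Rightarrow> 'a measure" where
  "gen_sigma M Y I = sigma (space M) {Y i -` B \<inter> space M | i B. i \<in> I \<and> B \<in> sets borel}"

definition f_wa :: "nat \<Rightarrow> (nat \<Rightarrow> 'a \<Rightarrow> real) \<Rightarrow> (nat \<Rightarrow> 'a \<Rightarrow> real) \<Rightarrow> 'a \<Rightarrow> real" where
  "f_wa n W R \<omega> = (\<Sum>i=1..n. W i \<omega> * R i \<omega>) / (\<Sum>j=1..n. W j \<omega>)"

definition Wt :: "nat \<Rightarrow> (nat \<Rightarrow> 'a \<Rightarrow> real) \<Rightarrow> nat \<Rightarrow> 'a \<Rightarrow> real" where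
  "Wt n W k \<omega> = W k \<omega> / (\<Sum>j=1..n. W j \<omega>)"

definition Ut :: "nat \<Rightarrow> (nat \<Rightarrow> 'a \<Rightarrow> real) \<Rightarrow> (nat \<Rightarrow> 'a \<Rightarrow> real) \<Rightarrow> nat \<Rightarrow> 'a \<Rightarrow> real" where
  "Ut n W W' k \<omega> = W' k \<omega> / (W' k \<omega> + (\<Sum>j\<in>{1..n} - {k}. W j \<omega>))"

definition V_wa :: "'a measure \<Rightarrow> nat \<Rightarrow> (nat \<Rightarrow> 'a \<Rightarrow> real) \<Rightarrow> (nat \<Rightarrow> 'a \<Rightarrow> real) \<Rightarrow> 'a \<Rightarrow> real" where
  "V_wa M n W W' \<omega> = (\<Sum>k=1..n. real_cond_exp M (gen_sigma M W {1..k})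
       (\<lambda>\<xi>. (Wt n W k \<xi>)\<^sup>2 + (Ut n W W' k \<xi>)\<^sup>2) \<omega>)"

end

theory Submission
  imports Defs
begin

text \<open>
  Let \<open>\<Delta> = f - E f\<close> and let \<open>f\<^sup>(\<^sup>k\<^sup>)\<close> be \<open>f\<close> with the \<open>k\<close>-th coordinate replaced by an independent copy.
  The differences of the Doob martingale of \<open>f\<close> are the conditional expectations of \<open>f - f\<^sup>(\<^sup>k\<^sup>)\<close> given the
  first \<open>k\<close> coordinates, and symmetrization yields \<open>E exp (t \<Delta> - t\<^sup>2 V / 2) \<le> 1\<close> for every real \<open>t\<close>,
  where \<open>V\<close> is the sum of the conditional expectations of any bounds on \<open>(f - f\<^sup>(\<^sup>k\<^sup>))\<^sup>2\<close>. Averaging over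
  a Gaussian \<open>t\<close> with variance \<open>1 / y\<close> gives \<open>E [sqrt (y / (V + y)) exp (\<Delta>\<^sup>2 / (2 (V + y)))] \<le> 1\<close>, and
  Markov's inequality concludes. For the weighted average one may take \<open>2 (W~\<^sub>k\<^sup>2 + U~\<^sub>k\<^sup>2)\<close> as the bound.
  It involves only the weights, so conditioning on \<open>W\<^sub>1, \<dots>, W\<^sub>k\<close> is the same as conditioning on the pairs.
\<close>

section \<open>Symmetrization and Gaussian mixtures\<close>

text \<open>Hoeffding's lemma for a fair random sign. Its auxiliary bound at
  \<open>h = 2 * s\<close> and \<open>p = 1/2\<close> reads
  \<open>- s + ln (exp s * cosh s) \<le> s\<^sup>2 / 2\<close>, and the two \<open>s\<close> on the
  left cancel. Both sides are even in \<open>t\<close>, which covers negative arguments.\<close>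

lemma cosh_le_exp_half_square: "cosh t \<le> exp (t\<^sup>2 / 2)" for t :: real
proof -
  have *: "cosh s \<le> exp (s\<^sup>2 / 2)" if "s \<ge> 0" for s :: real
  proof -
    have "1 + (exp (2 * s) - 1) / 2 = exp s * cosh s"
      by (simp add: cosh_def exp_minus field_simps flip: exp_add)
    then have "- s + ln (exp s * cosh s) \<le> s\<^sup>2 / 2"
      using Hoeffdings_lemma_aux[of "2 * s" "1/2"] that by (simp add: power2_eq_square)
    then have "ln (cosh s) \<le> s\<^sup>2 / 2"
      by (simp add: ln_mult)
    then show ?thesis
      by (metis cosh_real_pos exp_le_cancel_iff exp_ln)
  qed
  show ?thesis using *[of "\<bar>t\<bar>"] by simp
qed

text \<open>
  Jensen's inequality moves the exponential inside the integral over \<open>(z, x')\<close>. Swapping \<open>x\<close> and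
  \<open>x'\<close> then changes the sign of \<open>d = g x z - g x' z\<close>, so the integrand averages to
  \<open>cosh (t * d) * exp (- t\<^sup>2 * d\<^sup>2 / 2) \<le> 1\<close>.
\<close>

lemma nn_integral_exp_symmetrized_le_1:
  fixes g :: "'a \<Rightarrow> 'b \<Rightarrow> real" and q :: "'a \<Rightarrow> 'b \<Rightarrow> 'a \<Rightarrow> real"
  assumes "prob_space A" "prob_space B"
    and g [measurable]: "case_prod g \<in> borel_measurable (A \<Otimes>\<^sub>M B)"
    and q [measurable]: "(\<lambda>(x, z, x'). q x z x') \<in> borel_measurable (A \<Otimes>\<^sub>M B \<Otimes>\<^sub>M A)"
    and g_bound: "\<And>x z. x \<in> space A \<Longrightarrow> z \<in> space B \<Longrightarrow> \<bar>g x z\<bar> \<le> C"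
    and q_bound: "\<And>x z x'. x \<in> space A \<Longrightarrow> z \<in> space B \<Longrightarrow> x' \<in> space A \<Longrightarrow> \<bar>q x z x'\<bar> \<le> C"
    and dq: "\<And>x z x'. x \<in> space A \<Longrightarrow> z \<in> space B \<Longrightarrow> x' \<in> space A \<Longrightarrow>
               (g x z - g x' z)\<^sup>2 \<le> q x z x'"
  shows "(\<integral>\<^sup>+x. ennreal (exp (\<integral>(z, x'). t * (g x z - g x' z) - t\<^sup>2 / 2 * q x z x' \<partial>(B \<Otimes>\<^sub>M A))) \<partial>A) \<le> 1"
proof -
  interpret A: prob_space A by fact
  interpret B: prob_space B by fact
  interpret BA: pair_prob_space B A ..
  interpret AA: pair_prob_space A A ..
  interpret AB: pair_prob_space A B ..
  \<comment> \<open>\<open>K\<close> carries the squared difference where the integrand has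
    \<open>q\<close>. As \<open>q\<close> dominates it, the exponent only grows, and the quadratic
    term becomes symmetric in \<open>x\<close> and \<open>x'\<close>, which is not assumed of
    \<open>q\<close>.\<close>
  define K where "K x z x' = exp (t * (g x z - g x' z) - t\<^sup>2 / 2 * (g x z - g x' z)\<^sup>2)" for x z x'
  have g1 [measurable]: "(\<lambda>x. g (h1 x) (h2 x)) \<in> borel_measurable N"
    if "h1 \<in> N \<rightarrow>\<^sub>M A" "h2 \<in> N \<rightarrow>\<^sub>M B" for h1 h2 and N :: "'c measure"
    using measurable_compose[OF measurable_Pair[OF that] g] by simp
  have q1: "(\<lambda>x. q (h1 x) (h2 x) (h3 x)) \<in> borel_measurable N"
    if "h1 \<in> N \<rightarrow>\<^sub>M A" "h2 \<in> N \<rightarrow>\<^sub>M B" "h3 \<in> N \<rightarrow>\<^sub>M A" for h1 h2 h3 and N :: "'c measure"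
    using measurable_compose[OF measurable_Pair[OF that(1) measurable_Pair[OF that(2,3)]] q] by simp
  have KK: "K x z x' + K x' z x \<le> 2" for x z x'
  proof -
    define u where "u = t * (g x z - g x' z)"
    have "K x z x' = exp u * exp (- (u\<^sup>2 / 2))"
      by (simp add: K_def u_def power_mult_distrib flip: exp_add)
    moreover have e: "g x' z - g x z = - (g x z - g x' z)" by simp
    have "K x' z x = exp (- u) * exp (- (u\<^sup>2 / 2))"
      unfolding K_def e u_def by (simp add: power_mult_distrib del: minus_diff_eq flip: exp_add)
    ultimately have "K x z x' + K x' z x = 2 * (cosh u * exp (- (u\<^sup>2 / 2)))"
      by (simp add: cosh_def algebra_simps)
    also have "\<dots> \<le> 2 * (exp (u\<^sup>2 / 2) * exp (- (u\<^sup>2 / 2)))"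
      by (intro mult_left_mono mult_right_mono cosh_le_exp_half_square) auto
    finally show ?thesis by (simp flip: exp_add)
  qed
  have step: "ennreal (exp (\<integral>(z, x'). t * (g x z - g x' z) - t\<^sup>2 / 2 * q x z x' \<partial>(B \<Otimes>\<^sub>M A)))
      \<le> (\<integral>\<^sup>+z. \<integral>\<^sup>+x'. ennreal (K x z x') \<partial>A \<partial>B)" if x [simp]: "x \<in> space A" for x
  proof -
    define h where "h = (\<lambda>(z, x'). t * (g x z - g x' z) - t\<^sup>2 / 2 * q x z x')"
    have [measurable]: "h \<in> borel_measurable (B \<Otimes>\<^sub>M A)"
      using q1[of "\<lambda>_. x" "B \<Otimes>\<^sub>M A" fst snd] unfolding h_def split_beta' by measurable
    have C: "C \<ge> 0" using q_bound[OF x] B.not_empty by (metis abs_ge_zero all_not_in_conv order_trans x)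
    have hb: "\<bar>h p\<bar> \<le> \<bar>t\<bar> * (2 * C) + t\<^sup>2 / 2 * C" if "p \<in> space (B \<Otimes>\<^sub>M A)" for p
    proof -
      obtain z x' where p: "p = (z, x')" "z \<in> space B" "x' \<in> space A"
        using \<open>p \<in> _\<close> by (auto simp: space_pair_measure)
      have "\<bar>h p\<bar> \<le> \<bar>t * (g x z - g x' z)\<bar> + \<bar>t\<^sup>2 / 2 * q x z x'\<bar>"
        unfolding h_def p by simp
      also have "\<dots> \<le> \<bar>t\<bar> * (2 * C) + t\<^sup>2 / 2 * C"
        unfolding abs_mult using g_bound[OF x p(2)] g_bound[OF p(3,2)] q_bound[OF x p(2,3)]
        by (intro add_mono mult_mono) auto
      finally show ?thesis .
    qed
    have int: "integrable (B \<Otimes>\<^sub>M A) h"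
      by (rule BA.integrable_const_bound[OF AE_I2]) (use hb in auto)
    have inte: "integrable (B \<Otimes>\<^sub>M A) (\<lambda>p. exp (h p))"
      by (rule BA.integrable_const_bound[OF AE_I2, where B="exp (\<bar>t\<bar> * (2 * C) + t\<^sup>2 / 2 * C)"])
         (use hb in \<open>auto simp: abs_le_iff\<close>)
    have "exp (integral\<^sup>L (B \<Otimes>\<^sub>M A) h) \<le> (\<integral>p. exp (h p) \<partial>(B \<Otimes>\<^sub>M A))"
      by (rule BA.jensens_inequality[where I=UNIV]) (use int inte convex_on_exp[of 1] in auto)
    then have "ennreal (exp (integral\<^sup>L (B \<Otimes>\<^sub>M A) h)) \<le> (\<integral>\<^sup>+p. ennreal (exp (h p)) \<partial>(B \<Otimes>\<^sub>M A))"
      using inte by (subst nn_integral_eq_integral) auto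
    also have "\<dots> \<le> (\<integral>\<^sup>+p. ennreal (K x (fst p) (snd p)) \<partial>(B \<Otimes>\<^sub>M A))"
      unfolding K_def h_def using dq[OF x]
      by (intro nn_integral_mono) (auto simp: space_pair_measure intro!: mult_left_mono)
    also have "\<dots> = (\<integral>\<^sup>+z. \<integral>\<^sup>+x'. ennreal (K x z x') \<partial>A \<partial>B)"
      unfolding K_def by (subst A.nn_integral_fst[symmetric]) auto
    finally show ?thesis unfolding h_def .
  qed
  have inner: "(\<integral>\<^sup>+x. \<integral>\<^sup>+x'. ennreal (K x z x') \<partial>A \<partial>A) \<le> 1" if [simp]: "z \<in> space B" for z
  proof -
    \<comment> \<open>By Fubini the double integral equals its mirror image, so its double pairs
      \<open>K x z x'\<close> with \<open>K x' z x\<close>, and \<open>KK\<close> bounds each pair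
      by 2.\<close>
    have "2 * (\<integral>\<^sup>+x. \<integral>\<^sup>+x'. ennreal (K x z x') \<partial>A \<partial>A)
        = (\<integral>\<^sup>+x. \<integral>\<^sup>+x'. ennreal (K x z x') \<partial>A \<partial>A) + (\<integral>\<^sup>+x. \<integral>\<^sup>+x'. ennreal (K x' z x) \<partial>A \<partial>A)"
      unfolding K_def by (subst (3) AA.Fubini') (simp_all add: mult_2)
    also have "\<dots> = (\<integral>\<^sup>+x. \<integral>\<^sup>+x'. ennreal (K x z x' + K x' z x) \<partial>A \<partial>A)"
      unfolding K_def by (simp add: nn_integral_add)
    also have "\<dots> \<le> (\<integral>\<^sup>+x. \<integral>\<^sup>+x'. 2 \<partial>A \<partial>A)"
      using KK by (intro nn_integral_mono) (metis ennreal_leI ennreal_numeral zero_le_numeral)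
    also have "\<dots> = 2 * 1" by (simp add: A.emeasure_space_1)
    finally show ?thesis by (subst (asm) ennreal_mult_le_mult_iff) auto
  qed
  have "(\<integral>\<^sup>+x. ennreal (exp (\<integral>(z, x'). t * (g x z - g x' z) - t\<^sup>2 / 2 * q x z x' \<partial>(B \<Otimes>\<^sub>M A))) \<partial>A)
     \<le> (\<integral>\<^sup>+x. \<integral>\<^sup>+z. \<integral>\<^sup>+x'. ennreal (K x z x') \<partial>A \<partial>B \<partial>A)"
    by (intro nn_integral_mono step)
  also have "\<dots> = (\<integral>\<^sup>+z. \<integral>\<^sup>+x. \<integral>\<^sup>+x'. ennreal (K x z x') \<partial>A \<partial>A \<partial>B)"
    unfolding K_def by (rule AB.Fubini'[symmetric]) simp
  also have "\<dots> \<le> (\<integral>\<^sup>+z. 1 \<partial>B)" by (intro nn_integral_mono inner)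
  finally show ?thesis by (simp add: B.emeasure_space_1)
qed

text \<open>Completing the square: the product of the two exponentials is a Gaussian in
  \<open>t\<close> with mean \<open>a / (v + y)\<close> and precision \<open>v + y\<close>. The
  factor \<open>sqrt (y / (v + y))\<close> is the quotient of the normalizing constants.\<close>

lemma nn_integral_normal_density_exp_quadratic:
  fixes a v y :: real
  assumes "y > 0" "v \<ge> 0"
  shows "(\<integral>\<^sup>+t. ennreal (normal_density 0 (1 / sqrt y) t * exp (t * a - t\<^sup>2 / 2 * v)) \<partial>lborel)
    = ennreal (sqrt (y / (v + y)) * exp (a\<^sup>2 / (2 * (v + y))))"
proof -
  let ?c = "sqrt (y / (v + y)) * exp (a\<^sup>2 / (2 * (v + y)))"
  have pos: "v + y > 0" using assms by simp
  have eq: "normal_density 0 (1 / sqrt y) t * exp (t * a - t\<^sup>2 / 2 * v)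
      = ?c * normal_density (a / (v + y)) (1 / sqrt (v + y)) t" for t
  proof -
    have "- t\<^sup>2 * y / 2 + (t * a - t\<^sup>2 / 2 * v) = a\<^sup>2 / (2 * (v + y)) - (t - a / (v + y))\<^sup>2 * (v + y) / 2"
    proof -
      define m where "m = a / (v + y)"
      have a: "a = m * (v + y)" using pos by (simp add: m_def)
      have "a\<^sup>2 / (2 * (v + y)) = m\<^sup>2 * (v + y) / 2"
      proof -
        have "(m * s)\<^sup>2 / (2 * s) = m\<^sup>2 * s / 2" if "s \<noteq> 0" for s
          using that by (simp add: power2_eq_square)
        from this[of "v + y"] pos show ?thesis by (simp add: a)
      qed
      then show ?thesis
        unfolding m_def[symmetric] by (simp add: a power2_eq_square field_simps)
    qed
    then have E: "exp (- t\<^sup>2 * y / 2) * exp (t * a - t\<^sup>2 / 2 * v)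
        = exp (a\<^sup>2 / (2 * (v + y))) * exp (- (t - a / (v + y))\<^sup>2 * (v + y) / 2)"
      by (simp flip: exp_add)
    have S: "sqrt (y / (v + y)) * (1 / sqrt (2 * pi / (v + y))) = 1 / sqrt (2 * pi / y)"
      using assms pos by (simp add: real_sqrt_divide real_sqrt_mult field_simps)
    have N: "normal_density m (1 / sqrt s) t = 1 / sqrt (2 * pi / s) * exp (- (t - m)\<^sup>2 * s / 2)"
      if "s > 0" for m s :: real
      using that by (simp add: normal_density_def power_divide)
    show ?thesis
      using E by (simp only: N[OF \<open>y > 0\<close>] N[OF pos] S[symmetric] diff_zero mult.assoc) (simp only: mult_ac)
  qed
  have "(\<integral>\<^sup>+t. ennreal (normal_density (a / (v + y)) (1 / sqrt (v + y)) t) \<partial>lborel) = 1"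
    using pos by (subst nn_integral_eq_integral) auto
  then show ?thesis unfolding eq using assms pos
    by (simp add: ennreal_mult nn_integral_cmult)
qed

section \<open>Deviations of functions on a product space\<close>

text \<open>
  Here \<open>cmean k w\<close> and \<open>cvar k w\<close> are versions of the conditional expectations, given the first
  \<open>k\<close> coordinates, of \<open>f\<close> and of \<open>q k\<close> evaluated at an independent copy of the \<open>k\<close>-th coordinate.
  They read only the entries of \<open>w\<close> with index at most \<open>k\<close>.
\<close>

locale bounded_differences_product =
  fixes N :: "nat \<Rightarrow> 'b measure" and n :: nat and f :: "(nat \<Rightarrow> 'b) \<Rightarrow> real"
    and q :: "nat \<Rightarrow> (nat \<Rightarrow> 'b) \<Rightarrow> 'b \<Rightarrow> real" and C :: real
  assumes prob_N: "\<And>i. prob_space (N i)"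
    and f_measurable [measurable]: "f \<in> borel_measurable (PiM {1..n} N)"
    and q_measurable: "\<And>k. k \<in> {1..n} \<Longrightarrow>
          case_prod (q k) \<in> borel_measurable (PiM {1..n} N \<Otimes>\<^sub>M N k)"
    and f_bound: "\<And>w. w \<in> space (PiM {1..n} N) \<Longrightarrow> \<bar>f w\<bar> \<le> C"
    and q_bound: "\<And>k w x. k \<in> {1..n} \<Longrightarrow> w \<in> space (PiM {1..n} N) \<Longrightarrow> x \<in> space (N k) \<Longrightarrow> \<bar>q k w x\<bar> \<le> C"
    and square_diff_le_q: "\<And>k w x. k \<in> {1..n} \<Longrightarrow> w \<in> space (PiM {1..n} N) \<Longrightarrow> x \<in> space (N k) \<Longrightarrow>
          (f w - f (w(k := x)))\<^sup>2 \<le> q k w x"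
begin

text \<open>Otherwise simplification turns \<open>{1..n}\<close> into \<open>{Suc 0..n}\<close> and
  the index sets no longer match.\<close>

declare One_nat_def [simp del]

sublocale product_prob_space N "{1..n}"
  by (intro product_prob_space.intro product_sigma_finite.intro product_prob_space_axioms.intro
        prob_N prob_space_imp_sigma_finite)

abbreviation tail :: "nat \<Rightarrow> (nat \<Rightarrow> 'b) measure" where
  "tail k \<equiv> PiM {Suc k..n} N"

abbreviation glue :: "nat \<Rightarrow> (nat \<Rightarrow> 'b) \<Rightarrow> (nat \<Rightarrow> 'b) \<Rightarrow> nat \<Rightarrow> 'b" where
  "glue k w z \<equiv> merge {1..k} {Suc k..n} (w, z)"

definition cmean :: "nat \<Rightarrow> (nat \<Rightarrow> 'b) \<Rightarrow> real" where
  "cmean k w = (\<integral>z. f (glue k w z) \<partial>tail k)"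

definition cvar :: "nat \<Rightarrow> (nat \<Rightarrow> 'b) \<Rightarrow> real" where
  "cvar k w = (\<integral>(z, x). q k (glue k w z) x \<partial>(tail k \<Otimes>\<^sub>M N k))"

section \<open>Points glued from a prefix and a tail\<close>

lemma prob_space_PiM_N: "prob_space (PiM J N)"
  by (intro prob_space_PiM prob_N)

lemma prob_space_tail_pair: "prob_space (tail k \<Otimes>\<^sub>M N i)"
proof -
  interpret A: prob_space "tail k" by (rule prob_space_PiM_N)
  interpret T: pair_prob_space "tail k" "N i" ..
  show ?thesis by (rule T.prob_space_axioms)
qed

text \<open>Gluing ignores all entries of its first argument past \<open>k\<close>, so restricting
  that argument first changes nothing and reduces the claim to measurability of
  \<open>merge\<close>. The parameter \<open>m\<close> admits both bare prefixes and full points as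
  first argument.\<close>

lemma measurable_glue:
  assumes "k \<le> m" "k \<le> n" and h: "h1 \<in> L \<rightarrow>\<^sub>M PiM {1..m} N" "h2 \<in> L \<rightarrow>\<^sub>M tail k"
  shows "(\<lambda>x. glue k (h1 x) (h2 x)) \<in> L \<rightarrow>\<^sub>M PiM {1..n} N"
proof -
  have "(\<lambda>x. (restrict (h1 x) {1..k}, h2 x)) \<in> L \<rightarrow>\<^sub>M PiM {1..k} N \<Otimes>\<^sub>M tail k"
    using assms by (intro measurable_Pair measurable_compose[OF h(1)] measurable_restrict_subset) auto
  from measurable_compose[OF this measurable_merge]
  have "(\<lambda>x. glue k (restrict (h1 x) {1..k}) (h2 x)) \<in> L \<rightarrow>\<^sub>M PiM ({1..k} \<union> {Suc k..n}) N" .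
  moreover have "{1..k} \<union> {Suc k..n} = {1..n}" using assms by auto
  ultimately show ?thesis by simp
qed

lemma measurable_q_glue:
  assumes "k \<in> {1..n}" "k \<le> m" and h: "h1 \<in> L \<rightarrow>\<^sub>M PiM {1..m} N" "h2 \<in> L \<rightarrow>\<^sub>M tail k" "h3 \<in> L \<rightarrow>\<^sub>M N k"
  shows "(\<lambda>x. q k (glue k (h1 x) (h2 x)) (h3 x)) \<in> borel_measurable L"
proof -
  have "(\<lambda>x. glue k (h1 x) (h2 x)) \<in> L \<rightarrow>\<^sub>M PiM {1..n} N"
    using assms by (intro measurable_glue) auto
  from measurable_compose[OF measurable_Pair[OF this h(3)] q_measurable[OF assms(1)]] show ?thesis by simp
qed

lemma glue_in_space:
  assumes "k \<le> m" "k \<le> n" "w \<in> space (PiM {1..m} N)" "z \<in> space (tail k)"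
  shows "glue k w z \<in> space (PiM {1..n} N)"
  using assms by (auto simp: space_PiM PiE_iff merge_def extensional_def)

lemma glue_upd:
  assumes "k \<in> {1..n}"
  shows "(glue k w z)(k := x) = glue k (w(k := x)) z"
  using assms by (auto simp: merge_def fun_eq_iff)

text \<open>The coordinate \<open>Suc k\<close> may be counted as the end of the prefix or as the
  start of the tail. This links an integral over \<open>tail k\<close> to one over
  \<open>tail (Suc k)\<close> and a single coordinate.\<close>

lemma glue_Suc_upd:
  assumes "k < n"
  shows "glue (Suc k) (w(Suc k := x)) z = glue k w (z(Suc k := x))"
  using assms by (auto simp: merge_def fun_eq_iff)

lemma glue_0: "z \<in> space (tail 0) \<Longrightarrow> glue 0 w z = z"
  by (auto simp: merge_def fun_eq_iff space_PiM PiE_iff extensional_def)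

lemma glue_n: "w \<in> space (PiM {1..n} N) \<Longrightarrow> glue n w z = w"
  by (auto simp: merge_def fun_eq_iff space_PiM PiE_iff extensional_def)

lemma glue_upd_later: "k < i \<Longrightarrow> glue k (w(i := x)) z = glue k w z"
  by (auto simp: merge_def fun_eq_iff)

section \<open>The Doob martingale and its exponential supermartingale\<close>

lemma cmean_0: "cmean 0 w = (\<integral>w. f w \<partial>PiM {1..n} N)"
  unfolding cmean_def
proof (intro Bochner_Integration.integral_cong)
  \<comment> \<open>\<open>tail 0\<close> is indexed by \<open>{Suc 0..n}\<close>, which is
    \<open>{1..n}\<close> only after unfolding \<open>One_nat_def\<close>.\<close>
  show tail_0: "tail 0 = PiM {1..n} N" by (simp only: One_nat_def)
  fix z assume "z \<in> space (PiM {1..n} N)"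
  then show "f (glue 0 w z) = f z" by (simp only: glue_0 flip: tail_0)
qed

lemma cmean_n:
  assumes "w \<in> space (PiM {1..n} N)"
  shows "cmean n w = f w"
proof -
  interpret T: prob_space "tail n" by (rule prob_space_PiM_N)
  have "cmean n w = (\<integral>z. f w \<partial>tail n)" by (simp only: cmean_def glue_n[OF assms])
  also have "\<dots> = f w" by (simp only: lebesgue_integral_const T.prob_space) simp
  finally show ?thesis .
qed

lemma borel_measurable_cmean:
  assumes "k \<le> m" "k \<le> n"
  shows "cmean k \<in> borel_measurable (PiM {1..m} N)"
proof -
  interpret T: prob_space "tail k" by (rule prob_space_PiM_N)
  have [measurable]: "(\<lambda>x. glue k (fst x) (snd x)) \<in> PiM {1..m} N \<Otimes>\<^sub>M tail k \<rightarrow>\<^sub>M PiM {1..n} N"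
    using assms by (intro measurable_glue) auto
  show ?thesis unfolding cmean_def[abs_def]
  proof (intro T.borel_measurable_lebesgue_integral)
    show "(\<lambda>(w, z). f (glue k w z)) \<in> borel_measurable (PiM {1..m} N \<Otimes>\<^sub>M tail k)"
      unfolding split_beta' by measurable
  qed
qed

lemma borel_measurable_cvar:
  assumes "k \<le> m" "k \<in> {1..n}"
  shows "cvar k \<in> borel_measurable (PiM {1..m} N)"
proof -
  interpret T: prob_space "tail k \<Otimes>\<^sub>M N k" by (rule prob_space_tail_pair)
  have "(\<lambda>x. q k (glue k (fst x) (fst (snd x))) (snd (snd x)))
      \<in> borel_measurable (PiM {1..m} N \<Otimes>\<^sub>M (tail k \<Otimes>\<^sub>M N k))"
    using assms by (intro measurable_q_glue[where m=m]) auto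
  then show ?thesis unfolding cvar_def[abs_def]
    by (intro T.borel_measurable_lebesgue_integral) (simp add: split_beta')
qed

lemma cvar_nonneg:
  assumes "k \<le> m" "k \<in> {1..n}" "w \<in> space (PiM {1..m} N)"
  shows "cvar k w \<ge> 0"
  unfolding cvar_def
proof (intro Bochner_Integration.integral_nonneg)
  fix p assume "p \<in> space (tail k \<Otimes>\<^sub>M N k)"
  then obtain z x where p: "p = (z, x)" "z \<in> space (tail k)" "x \<in> space (N k)"
    by (auto simp: space_pair_measure)
  have "glue k w z \<in> space (PiM {1..n} N)"
    using assms p by (intro glue_in_space) auto
  with square_diff_le_q[OF assms(2) this p(3)] show "0 \<le> (case p of (z, x) \<Rightarrow> q k (glue k w z) x)"
    unfolding p by (auto intro: order_trans[rotated])
qed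

text \<open>This turns the exponent of the symmetrization bound into a martingale increment. The
  term in \<open>x\<close> is constant in \<open>x'\<close> and integrates to
  \<open>cmean (Suc k)\<close>. In the other term \<open>x'\<close> together with \<open>z\<close>
  runs through all of \<open>tail k\<close>, which gives \<open>cmean k\<close>. The
  \<open>q\<close> term is \<open>cvar\<close> by definition.\<close>

lemma integral_symmetrized_eq:
  assumes k: "k < n" and w: "w \<in> space (PiM {1..k} N)" and x: "x \<in> space (N (Suc k))"
  shows "(\<integral>(z, x'). t * (f (glue (Suc k) (w(Suc k := x)) z) - f (glue (Suc k) (w(Suc k := x')) z))
              - t\<^sup>2 / 2 * q (Suc k) (glue (Suc k) (w(Suc k := x)) z) x' \<partial>(tail (Suc k) \<Otimes>\<^sub>M N (Suc k)))
    = t * (cmean (Suc k) (w(Suc k := x)) - cmean k w) - t\<^sup>2 / 2 * cvar (Suc k) (w(Suc k := x))"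
proof -
  let ?B = "tail (Suc k)" and ?A = "N (Suc k)"
  interpret B: prob_space ?B by (rule prob_space_PiM_N)
  interpret BA: pair_prob_space ?B ?A ..
  have ins: "{1..Suc k} = {1..k} \<union> {Suc k}" by auto
  have upd: "v(Suc k := y) \<in> space (PiM {1..Suc k} N)" if "v \<in> space (PiM {1..k} N)" "y \<in> space ?A" for v y
    using that by (auto simp: space_PiM PiE_iff extensional_def)
  have [measurable]: "(\<lambda>p. glue (Suc k) (w(Suc k := x)) (fst p)) \<in> ?B \<Otimes>\<^sub>M ?A \<rightarrow>\<^sub>M PiM {1..n} N"
    using k upd[OF w x] by (intro measurable_glue[where m="Suc k"]) auto
  have [measurable]: "(\<lambda>p. glue (Suc k) (w(Suc k := snd p)) (fst p)) \<in> ?B \<Otimes>\<^sub>M ?A \<rightarrow>\<^sub>M PiM {1..n} N"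
    using k w by (intro measurable_glue[where m="Suc k"] measurable_fun_upd[OF ins]) auto
  have i1: "integrable (?B \<Otimes>\<^sub>M ?A) (\<lambda>p. f (glue (Suc k) (w(Suc k := x)) (fst p)))"
    using k by (intro BA.integrable_const_bound[where B=C] AE_I2)
       (auto intro!: f_bound glue_in_space[OF _ _ upd[OF w x]] simp: space_pair_measure)
  have i2: "integrable (?B \<Otimes>\<^sub>M ?A) (\<lambda>p. f (glue (Suc k) (w(Suc k := snd p)) (fst p)))"
    using k by (intro BA.integrable_const_bound[where B=C] AE_I2)
       (auto intro!: f_bound glue_in_space[OF _ _ upd[OF w]] simp: space_pair_measure)
  have i3: "integrable (?B \<Otimes>\<^sub>M ?A) (\<lambda>p. q (Suc k) (glue (Suc k) (w(Suc k := x)) (fst p)) (snd p))"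
    using k by (intro BA.integrable_const_bound[where B=C] AE_I2 measurable_q_glue[where m="Suc k"]
        measurable_const)
       (auto intro!: q_bound glue_in_space[OF _ _ upd[OF w x]] upd[OF w x] simp: space_pair_measure)
  have e1: "(\<integral>p. f (glue (Suc k) (w(Suc k := x)) (fst p)) \<partial>(?B \<Otimes>\<^sub>M ?A)) = cmean (Suc k) (w(Suc k := x))"
    unfolding cmean_def by (subst BA.integral_fst'[symmetric, OF i1]) (simp add: prob_space.prob_space[OF prob_N])
  have e2: "(\<integral>p. f (glue (Suc k) (w(Suc k := snd p)) (fst p)) \<partial>(?B \<Otimes>\<^sub>M ?A)) = cmean k w"
  proof -
    have J: "{Suc k..n} = insert (Suc k) {Suc (Suc k)..n}" using k by auto
    interpret T: prob_space "PiM (insert (Suc k) {Suc (Suc k)..n}) N" by (rule prob_space_PiM_N)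
    have [measurable]: "(\<lambda>z. glue k w z) \<in> tail k \<rightarrow>\<^sub>M PiM {1..n} N"
      using k w by (intro measurable_glue[where m=k]) auto
    have "cmean k w = (\<integral>z. (\<integral>y. f (glue k w (z(Suc k := y))) \<partial>?A) \<partial>?B)"
      unfolding cmean_def J
    proof (intro product_integral_insert T.integrable_const_bound[where B=C] AE_I2; (fold J)?)
      show "(\<lambda>z. f (glue k w z)) \<in> borel_measurable (tail k)" by measurable
    qed (use k w in \<open>auto intro!: f_bound glue_in_space[where m=k]\<close>)
    then show ?thesis
      by (subst BA.integral_fst'[symmetric, OF i2]) (simp add: glue_Suc_upd[OF k])
  qed
  show ?thesis
    unfolding cvar_def split_beta' using i1 i2 i3 e1 e2
    by (simp add: Bochner_Integration.integral_diff)
qed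

text \<open>The symmetrization bound with the first \<open>k\<close> coordinates frozen, the
  coordinate \<open>Suc k\<close> as the variable to be swapped with its copy, and the remaining
  tail as the auxiliary space.\<close>

lemma nn_integral_exp_step_le_1:
  assumes k: "k < n" and w: "w \<in> space (PiM {1..k} N)"
  shows "(\<integral>\<^sup>+x. ennreal (exp (t * (cmean (Suc k) (w(Suc k := x)) - cmean k w)
            - t\<^sup>2 / 2 * cvar (Suc k) (w(Suc k := x)))) \<partial>N (Suc k)) \<le> 1"
proof -
  let ?B = "tail (Suc k)" and ?A = "N (Suc k)"
  have ins: "{1..Suc k} = {1..k} \<union> {Suc k}" by auto
  have upd: "v(Suc k := y) \<in> space (PiM {1..Suc k} N)" if "v \<in> space (PiM {1..k} N)" "y \<in> space ?A" for v y
    using that by (auto simp: space_PiM PiE_iff extensional_def)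
  have k': "Suc k \<in> {1..n}" using k by auto
  have "(\<integral>\<^sup>+x. ennreal (exp (\<integral>(z, x').
        t * (f (glue (Suc k) (w(Suc k := x)) z) - f (glue (Suc k) (w(Suc k := x')) z))
              - t\<^sup>2 / 2 * q (Suc k) (glue (Suc k) (w(Suc k := x)) z) x' \<partial>(?B \<Otimes>\<^sub>M ?A))) \<partial>?A) \<le> 1"
  proof (rule nn_integral_exp_symmetrized_le_1[where C=C])
    show "prob_space ?A" by (rule prob_N)
    show "prob_space ?B" by (rule prob_space_PiM_N)
    have [measurable]: "(\<lambda>p. glue (Suc k) (w(Suc k := fst p)) (snd p)) \<in> ?A \<Otimes>\<^sub>M ?B \<rightarrow>\<^sub>M PiM {1..n} N"
      using k w by (intro measurable_glue[where m="Suc k"] measurable_fun_upd[OF ins]) auto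
    show "(\<lambda>(x, z). f (glue (Suc k) (w(Suc k := x)) z)) \<in> borel_measurable (?A \<Otimes>\<^sub>M ?B)"
      unfolding split_beta' by measurable
    show "(\<lambda>(x, z, x'). q (Suc k) (glue (Suc k) (w(Suc k := x)) z) x') \<in> borel_measurable (?A \<Otimes>\<^sub>M ?B \<Otimes>\<^sub>M ?A)"
      unfolding split_beta' using k w
      by (intro measurable_q_glue[where m="Suc k"] measurable_fun_upd[OF ins]) auto
    fix x z assume xz: "x \<in> space ?A" "z \<in> space ?B"
    have G: "glue (Suc k) (w(Suc k := x)) z \<in> space (PiM {1..n} N)"
      using k xz w by (intro glue_in_space[where m="Suc k"] upd) auto
    then show "\<bar>f (glue (Suc k) (w(Suc k := x)) z)\<bar> \<le> C" by (rule f_bound)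
    fix x' assume x': "x' \<in> space ?A"
    show "\<bar>q (Suc k) (glue (Suc k) (w(Suc k := x)) z) x'\<bar> \<le> C"
      by (rule q_bound[OF k' G x'])
    show "(f (glue (Suc k) (w(Suc k := x)) z) - f (glue (Suc k) (w(Suc k := x')) z))\<^sup>2
        \<le> q (Suc k) (glue (Suc k) (w(Suc k := x)) z) x'"
      using square_diff_le_q[OF k' G x'] by (simp add: glue_upd[OF k'])
  qed
  also have "(\<integral>\<^sup>+x. ennreal (exp (\<integral>(z, x').
        t * (f (glue (Suc k) (w(Suc k := x)) z) - f (glue (Suc k) (w(Suc k := x')) z))
              - t\<^sup>2 / 2 * q (Suc k) (glue (Suc k) (w(Suc k := x)) z) x' \<partial>(?B \<Otimes>\<^sub>M ?A))) \<partial>?A)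
     = (\<integral>\<^sup>+x. ennreal (exp (t * (cmean (Suc k) (w(Suc k := x)) - cmean k w)
            - t\<^sup>2 / 2 * cvar (Suc k) (w(Suc k := x)))) \<partial>?A)"
    by (intro nn_integral_cong arg_cong[where f=ennreal] arg_cong[where f=exp] integral_symmetrized_eq k w)
  finally show ?thesis .
qed

text \<open>Induction integrates out the last coordinate. The exponential splits into its
  predecessor, which does not read the coordinate \<open>Suc m\<close>, and one increment factor,
  whose integral over that coordinate is at most 1.\<close>

lemma nn_integral_exp_supermartingale_le_1:
  assumes "m \<le> n"
  shows "(\<integral>\<^sup>+w. ennreal (exp (t * (cmean m w - cmean 0 w) - t\<^sup>2 / 2 * (\<Sum>k=1..m. cvar k w)))
            \<partial>PiM {1..m} N) \<le> 1"
  using assms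
proof (induction m)
  case 0
  show ?case using prob_space.emeasure_space_1[OF prob_space_PiM_N, of "{1..0}"] by simp
next
  case (Suc m)
  let ?E = "\<lambda>m w. exp (t * (cmean m w - cmean 0 w) - t\<^sup>2 / 2 * (\<Sum>k=1..m. cvar k w))"
  have ins: "{1..Suc m} = insert (Suc m) {1..m}" by auto
  then have P: "PiM {1..Suc m} N = PiM (insert (Suc m) {1..m}) N" by simp
  have [measurable]: "cmean k \<in> borel_measurable (PiM {1..Suc m} N)" if "k \<le> Suc m" for k
    using Suc that by (intro borel_measurable_cmean) auto
  have [measurable]: "cvar k \<in> borel_measurable (PiM {1..Suc m} N)" if "k \<in> {1..Suc m}" for k
    using Suc that by (intro borel_measurable_cvar) auto
  have meas: "(\<lambda>w. ennreal (?E (Suc m) w)) \<in> borel_measurable (PiM (insert (Suc m) {1..m}) N)"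
    unfolding ins[symmetric] by measurable
  have split: "?E (Suc m) (w(Suc m := x)) = ?E m w *
      exp (t * (cmean (Suc m) (w(Suc m := x)) - cmean m w) - t\<^sup>2 / 2 * cvar (Suc m) (w(Suc m := x)))" for w x
  proof -
    have "(\<Sum>k=1..m. cvar k (w(Suc m := x))) = (\<Sum>k=1..m. cvar k w)"
      by (intro sum.cong) (auto simp: cvar_def glue_upd_later)
    then show ?thesis
      by (simp add: cmean_0 algebra_simps flip: exp_add)
  qed
  have "(\<integral>\<^sup>+w. ennreal (?E (Suc m) w) \<partial>PiM {1..Suc m} N)
      = (\<integral>\<^sup>+w. \<integral>\<^sup>+x. ennreal (?E (Suc m) (w(Suc m := x))) \<partial>N (Suc m) \<partial>PiM {1..m} N)"
    unfolding P by (rule product_nn_integral_insert[OF _ _ meas]) auto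
  also have "\<dots> = (\<integral>\<^sup>+w. ennreal (?E m w) * (\<integral>\<^sup>+x. ennreal (exp (t * (cmean (Suc m) (w(Suc m := x)) - cmean m w)
            - t\<^sup>2 / 2 * cvar (Suc m) (w(Suc m := x)))) \<partial>N (Suc m)) \<partial>PiM {1..m} N)"
  proof (intro nn_integral_cong)
    fix w assume w [simp]: "w \<in> space (PiM {1..m} N)"
    have [measurable]: "(\<lambda>x. w(Suc m := x)) \<in> N (Suc m) \<rightarrow>\<^sub>M PiM {1..Suc m} N"
      unfolding ins by (rule measurable_component_update) auto
    show "(\<integral>\<^sup>+x. ennreal (?E (Suc m) (w(Suc m := x))) \<partial>N (Suc m)) =
       ennreal (?E m w) * (\<integral>\<^sup>+x. ennreal (exp (t * (cmean (Suc m) (w(Suc m := x)) - cmean m w)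
            - t\<^sup>2 / 2 * cvar (Suc m) (w(Suc m := x)))) \<partial>N (Suc m))"
      unfolding split by (subst nn_integral_cmult[symmetric]) (auto simp: ennreal_mult)
  qed
  also have "\<dots> \<le> (\<integral>\<^sup>+w. ennreal (?E m w) * 1 \<partial>PiM {1..m} N)"
    using Suc by (intro nn_integral_mono mult_left_mono nn_integral_exp_step_le_1) auto
  also have "\<dots> \<le> 1" using Suc by simp
  finally show ?case .
qed

section \<open>Gaussian mixture and tail bound\<close>

abbreviation "mean \<equiv> \<integral>w. f w \<partial>PiM {1..n} N"

text \<open>An adapted rather than predictable variance proxy: term \<open>k\<close> is conditioned
  on the first \<open>k\<close> coordinates, the \<open>k\<close>-th included.\<close>

definition "total_cvar w = (\<Sum>k=1..n. cvar k w)"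

lemma total_cvar_nonneg: "w \<in> space (PiM {1..n} N) \<Longrightarrow> total_cvar w \<ge> 0"
  unfolding total_cvar_def by (intro sum_nonneg cvar_nonneg) auto

lemma borel_measurable_total_cvar [measurable]: "total_cvar \<in> borel_measurable (PiM {1..n} N)"
  unfolding total_cvar_def[abs_def] by (intro borel_measurable_sum borel_measurable_cvar) auto

lemma nn_integral_exp_le_1:
  "(\<integral>\<^sup>+w. ennreal (exp (t * (f w - mean) - t\<^sup>2 / 2 * total_cvar w)) \<partial>PiM {1..n} N) \<le> 1"
proof -
  have "(\<integral>\<^sup>+w. ennreal (exp (t * (f w - mean) - t\<^sup>2 / 2 * total_cvar w)) \<partial>PiM {1..n} N)
    = (\<integral>\<^sup>+w. ennreal (exp (t * (cmean n w - cmean 0 w) - t\<^sup>2 / 2 * (\<Sum>k=1..n. cvar k w))) \<partial>PiM {1..n} N)"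
    by (intro nn_integral_cong) (simp add: cmean_n cmean_0 total_cvar_def)
  also have "\<dots> \<le> 1" by (rule nn_integral_exp_supermartingale_le_1) simp
  finally show ?thesis .
qed

text \<open>Method of mixtures: \<open>nn_integral_exp_le_1\<close> holds for each fixed
  \<open>t\<close>, so it survives averaging over a centred Gaussian \<open>t\<close> with variance
  \<open>1 / y\<close>. Tonelli lets the average over \<open>t\<close> be taken first, where it has
  a closed form because \<open>total_cvar\<close> is nonnegative.\<close>

lemma nn_integral_mixture_le_1:
  assumes "y > 0"
  shows "(\<integral>\<^sup>+w. ennreal (sqrt (y / (total_cvar w + y)) *
            exp ((f w - mean)\<^sup>2 / (2 * (total_cvar w + y)))) \<partial>PiM {1..n} N) \<le> 1"
proof -
  interpret P: prob_space "PiM {1..n} N" by (rule prob_space_PiM_N)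
  interpret pair_sigma_finite "PiM {1..n} N" lborel ..
  let ?g = "\<lambda>t w. ennreal (normal_density 0 (1 / sqrt y) t * exp (t * (f w - mean) - t\<^sup>2 / 2 * total_cvar w))"
  have "(\<integral>\<^sup>+w. ennreal (sqrt (y / (total_cvar w + y)) *
            exp ((f w - mean)\<^sup>2 / (2 * (total_cvar w + y)))) \<partial>PiM {1..n} N)
     = (\<integral>\<^sup>+w. \<integral>\<^sup>+t. ?g t w \<partial>lborel \<partial>PiM {1..n} N)"
    using assms
    by (intro nn_integral_cong nn_integral_normal_density_exp_quadratic[symmetric] total_cvar_nonneg) auto
  also have "\<dots> = (\<integral>\<^sup>+t. \<integral>\<^sup>+w. ?g t w \<partial>PiM {1..n} N \<partial>lborel)"
    by (rule Fubini'[symmetric]) measurable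
  also have "\<dots> = (\<integral>\<^sup>+t. ennreal (normal_density 0 (1 / sqrt y) t) *
      (\<integral>\<^sup>+w. ennreal (exp (t * (f w - mean) - t\<^sup>2 / 2 * total_cvar w)) \<partial>PiM {1..n} N) \<partial>lborel)"
    by (intro nn_integral_cong, subst nn_integral_cmult[symmetric]) (auto simp: ennreal_mult)
  also have "\<dots> \<le> (\<integral>\<^sup>+t. ennreal (normal_density 0 (1 / sqrt y) t) * 1 \<partial>lborel)"
    by (intro nn_integral_mono mult_left_mono nn_integral_exp_le_1) auto
  also have "\<dots> = 1"
    using assms by (simp, subst nn_integral_eq_integral) auto
  finally show ?thesis .
qed

text \<open>By Markov's inequality the mixture \<open>u\<close> stays below \<open>exp x\<close>
  outside an event of probability at most \<open>exp (- x)\<close>. With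
  \<open>v = total_cvar w\<close>, \<open>a = f w - mean\<close> and
  \<open>l = ln (sqrt (1 + v / y))\<close>, the bound \<open>u w < exp x\<close> says that
  \<open>a\<^sup>2 < 2 * (v + y) * (x + l)\<close>.\<close>

theorem prob_deviation_ge:
  assumes "y > 0" "x \<ge> 1"
  shows "measure (PiM {1..n} N) {w \<in> space (PiM {1..n} N).
     \<bar>f w - mean\<bar> \<le> sqrt (2 * (total_cvar w + y) * (1 + ln (sqrt (1 + total_cvar w / y))) * x)} \<ge> 1 - exp (- x)"
    (is "measure ?P ?G \<ge> _")
proof -
  interpret P: prob_space ?P by (rule prob_space_PiM_N)
  define u where "u w = sqrt (y / (total_cvar w + y)) *
            exp ((f w - mean)\<^sup>2 / (2 * (total_cvar w + y)))" for w
  have [measurable]: "u \<in> borel_measurable ?P" unfolding u_def[abs_def] by measurable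
  \<comment> \<open>The event \<open>exp x \<le> u w\<close>, in the multiplied form that Markov's
    inequality expects.\<close>
  let ?B = "{w \<in> space ?P. 1 \<le> ennreal (exp (- x)) * ennreal (u w)}"
  have "emeasure ?P ?B \<le> ennreal (exp (- x)) * (\<integral>\<^sup>+w. ennreal (u w) * indicator (space ?P) w \<partial>?P)"
    by (rule nn_integral_Markov_inequality) auto
  also have "(\<integral>\<^sup>+w. ennreal (u w) * indicator (space ?P) w \<partial>?P) = (\<integral>\<^sup>+w. ennreal (u w) \<partial>?P)"
    by (intro nn_integral_cong) auto
  also have "ennreal (exp (- x)) * (\<integral>\<^sup>+w. ennreal (u w) \<partial>?P) \<le> ennreal (exp (- x)) * 1"
    unfolding u_def by (intro mult_left_mono nn_integral_mixture_le_1 assms) auto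
  finally have B: "P.prob ?B \<le> exp (- x)"
    by (simp add: P.emeasure_eq_measure)
  have "space ?P - ?B \<subseteq> ?G"
  proof (intro subsetI, rule ccontr)
    fix w assume wB: "w \<in> space ?P - ?B" and wG: "w \<notin> ?G"
    then have w: "w \<in> space ?P" by simp
    define v a where "v = total_cvar w" and "a = f w - mean"
    define l where "l = ln (sqrt (1 + v / y))"
    have v: "v \<ge> 0" using total_cvar_nonneg[OF w] by (simp add: v_def)
    have vy: "v + y > 0" using v assms by simp
    have l: "l \<ge> 0" using v assms by (simp add: l_def)
    have "sqrt (2 * (v + y) * (1 + l) * x) < \<bar>a\<bar>"
      using wG w by (simp add: v_def a_def l_def)
    then have "2 * (v + y) * (1 + l) * x < a\<^sup>2"
      by (metis linorder_not_less real_sqrt_le_mono real_sqrt_abs)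
    \<comment> \<open>Here \<open>1 \<le> x\<close> turns the additive \<open>l\<close> into the
      factor \<open>1 + l\<close> of the stated bound.\<close>
    moreover have "x + l \<le> (1 + l) * x"
      using mult_left_mono[OF assms(2) l] by (simp add: algebra_simps)
    then have "2 * (v + y) * (x + l) \<le> 2 * (v + y) * ((1 + l) * x)"
      using vy by (intro mult_left_mono) auto
    ultimately have "2 * (v + y) * (x + l) < a\<^sup>2" by (simp add: mult.assoc)
    then have "x + l < a\<^sup>2 / (2 * (v + y))"
      using vy by (simp add: pos_less_divide_eq mult_ac)
    then have "exp (x + l) \<le> exp (a\<^sup>2 / (2 * (v + y)))" by simp
    \<comment> \<open>So \<open>exp l\<close> cancels exactly the prefactor
      \<open>sqrt (y / (v + y))\<close> of \<open>u\<close>, leaving \<open>exp x\<close>.\<close>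
    moreover have "exp l = sqrt ((v + y) / y)"
      using v assms vy by (simp add: l_def add_pos_nonneg add_divide_distrib add.commute)
    moreover have "sqrt (y / (v + y)) * sqrt ((v + y) / y) = 1"
      using assms vy by (simp flip: real_sqrt_mult)
    ultimately have "exp x \<le> u w"
      using mult_left_mono[of "exp (x + l)" "exp (a\<^sup>2 / (2 * (v + y)))" "sqrt (y / (v + y))"] assms vy
      by (simp add: u_def v_def a_def exp_add mult_ac)
    then have "1 \<le> exp (- x) * u w"
      using mult_left_mono[of "exp x" "u w" "exp (- x)"] by (simp flip: exp_add)
    then have "1 \<le> ennreal (exp (- x)) * ennreal (u w)"
      by (metis ennreal_1 ennreal_leI ennreal_mult' exp_ge_zero)
    with wB show False by simp
  qed
  then have "P.prob (space ?P - ?B) \<le> P.prob ?G"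
    by (intro P.finite_measure_mono) measurable
  moreover have "P.prob (space ?P - ?B) = 1 - P.prob ?B"
    by (rule P.prob_compl) measurable
  ultimately show ?thesis using B by simp
qed

section \<open>\<open>cvar\<close> as a conditional expectation given a prefix\<close>

lemma integral_eq_iterated:
  assumes "k \<le> n" and h: "integrable (PiM {1..n} N) h"
  shows "(\<integral>w. h w \<partial>PiM {1..n} N) = (\<integral>w. (\<integral>z. h (glue k w z) \<partial>tail k) \<partial>PiM {1..k} N :: real)"
proof -
  have *: "{1..n} = {1..k} \<union> {Suc k..n}" using assms by auto
  have "{1..k} \<inter> {Suc k..n} = {}" by auto
  from product_integral_fold[OF this _ _ h[unfolded *]] show ?thesis by (simp add: *)
qed

lemma cvar_cong:
  assumes "\<And>i. i \<in> {1..k} \<Longrightarrow> w i = w' i"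
  shows "cvar k w = cvar k w'"
proof -
  have "glue k w z = glue k w' z" for z using assms by (auto simp: merge_def fun_eq_iff)
  then show ?thesis by (simp only: cvar_def)
qed

lemma abs_cvar_le:
  assumes "k \<le> m" "k \<in> {1..n}" "w \<in> space (PiM {1..m} N)"
  shows "\<bar>cvar k w\<bar> \<le> C"
proof -
  interpret T: prob_space "tail k \<Otimes>\<^sub>M N k" by (rule prob_space_tail_pair)
  have *: "\<bar>q k (glue k w z) x\<bar> \<le> C" if "z \<in> space (tail k)" "x \<in> space (N k)" for z x
    using assms that by (intro q_bound glue_in_space) auto
  have "(\<lambda>p. q k (glue k w (fst p)) (snd p)) \<in> borel_measurable (tail k \<Otimes>\<^sub>M N k)"
    using assms by (intro measurable_q_glue[where m=m]) auto
  then have int: "integrable (tail k \<Otimes>\<^sub>M N k) (\<lambda>(z, x). q k (glue k w z) x)"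
    by (intro T.integrable_const_bound[where B=C] AE_I2) (auto simp: space_pair_measure split_beta' *)
  have "(\<integral>(z, x). q k (glue k w z) x \<partial>(tail k \<Otimes>\<^sub>M N k)) \<le> C"
    using * by (intro T.integral_le_const[OF int] AE_I2) (auto simp: space_pair_measure abs_le_iff)
  moreover have "- C \<le> (\<integral>(z, x). q k (glue k w z) x \<partial>(tail k \<Otimes>\<^sub>M N k))"
    using * by (intro T.integral_ge_const[OF int] AE_I2) (force simp: space_pair_measure abs_le_iff)
  ultimately show ?thesis by (simp add: cvar_def abs_le_iff)
qed

text \<open>The averaging property of conditional expectation, to be used with indicators
  \<open>h\<close> of prefix events. Splitting the product at \<open>k\<close>, the factor
  \<open>h\<close> is constant along the tail, so the tail integral yields \<open>cvar k\<close>. As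
  \<open>cvar k\<close> is itself constant along the tail, which has mass 1, the prefix integral
  lifts back to the full product.\<close>

lemma integral_prefix_cvar:
  fixes h :: "(nat \<Rightarrow> 'b) \<Rightarrow> real"
  assumes k: "k \<in> {1..n}" and h [measurable]: "h \<in> borel_measurable (PiM {1..k} N)"
    and h_bound: "\<And>w. \<bar>h w\<bar> \<le> 1"
  shows "(\<integral>w. h (restrict w {1..k}) * (\<integral>x. q k w x \<partial>N k) \<partial>PiM {1..n} N)
       = (\<integral>w. h (restrict w {1..k}) * cvar k w \<partial>PiM {1..n} N)"
proof -
  let ?P = "PiM {1..n} N"
  interpret P: prob_space ?P by (rule prob_space_PiM_N)
  interpret B: prob_space "tail k" by (rule prob_space_PiM_N)
  interpret BA: pair_prob_space "tail k" "N k" ..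
  have C: "C \<ge> 0"
    using f_bound P.not_empty by (metis abs_ge_zero all_not_in_conv order_trans)
  have [measurable]: "case_prod (q k) \<in> borel_measurable (?P \<Otimes>\<^sub>M N k)" by (rule q_measurable[OF k])
  have [measurable]: "cvar k \<in> borel_measurable ?P" using k by (intro borel_measurable_cvar) auto
  have [measurable]: "(\<lambda>w. h (restrict w {1..k})) \<in> borel_measurable ?P"
    using k by (intro measurable_compose[OF _ h] measurable_restrict_subset) auto
  have qint: "integrable (N k) (q k w)" if "w \<in> space ?P" for w
    using that q_bound[OF k that] by (intro M.integrable_const_bound[where B=C] AE_I2) auto
  have restr: "h (restrict (glue k w z) {1..k}) = h w" if "w \<in> space (PiM {1..k} N)" for w z
  proof -
    have "restrict (glue k w z) {1..k} = w"
      using that by (auto simp: merge_def fun_eq_iff space_PiM PiE_iff extensional_def)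
    then show ?thesis by simp
  qed
  have bnd: "\<bar>h v * c\<bar> \<le> C" if "\<bar>c\<bar> \<le> C" for v c
    unfolding abs_mult using mult_mono[OF h_bound[of v] that] C by simp
  have "(\<integral>w. h (restrict w {1..k}) * (\<integral>x. q k w x \<partial>N k) \<partial>?P)
     = (\<integral>w. (\<integral>z. h (restrict (glue k w z) {1..k}) * (\<integral>x. q k (glue k w z) x \<partial>N k) \<partial>tail k) \<partial>PiM {1..k} N)"
  proof (intro integral_eq_iterated P.integrable_const_bound[where B=C] AE_I2)
    fix w assume w: "w \<in> space ?P"
    have "\<bar>\<integral>x. q k w x \<partial>N k\<bar> \<le> C"
      unfolding abs_le_iff using q_bound[OF k w]
      by (auto intro!: M.integral_le_const qint[OF w] AE_I2 simp: abs_le_iff simp flip: Bochner_Integration.integral_minus)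
    from bnd[OF this] show "norm (h (restrict w {1..k}) * (\<integral>x. q k w x \<partial>N k)) \<le> C" by simp
  qed (use k in auto)
  also have "\<dots> = (\<integral>w. h w * cvar k w \<partial>PiM {1..k} N)"
  proof (intro Bochner_Integration.integral_cong refl)
    fix w assume w: "w \<in> space (PiM {1..k} N)"
    have "(\<lambda>p. q k (glue k w (fst p)) (snd p)) \<in> borel_measurable (tail k \<Otimes>\<^sub>M N k)"
      using k w by (intro measurable_q_glue[where m=k]) auto
    then have int: "integrable (tail k \<Otimes>\<^sub>M N k) (\<lambda>(z, x). q k (glue k w z) x)"
      using k w by (intro BA.integrable_const_bound[where B=C] AE_I2)
       (auto intro!: q_bound glue_in_space[where m=k] simp: space_pair_measure split_beta')
    have "(\<integral>z. h (restrict (glue k w z) {1..k}) * (\<integral>x. q k (glue k w z) x \<partial>N k) \<partial>tail k)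
       = h w * (\<integral>z. (\<integral>x. q k (glue k w z) x \<partial>N k) \<partial>tail k)"
      by (simp add: restr[OF w] del: restrict_merge)
    also have "\<dots> = h w * cvar k w"
      using BA.integral_fst'[OF int] by (simp add: cvar_def)
    finally show "(\<integral>z. h (restrict (glue k w z) {1..k}) * (\<integral>x. q k (glue k w z) x \<partial>N k) \<partial>tail k) = h w * cvar k w" .
  qed
  also have "\<dots> = (\<integral>w. (\<integral>z. h (restrict (glue k w z) {1..k}) * cvar k (glue k w z) \<partial>tail k) \<partial>PiM {1..k} N)"
  proof (intro Bochner_Integration.integral_cong refl)
    fix w assume w: "w \<in> space (PiM {1..k} N)"
    have "cvar k (glue k w z) = cvar k w" for z
      by (rule cvar_cong) (auto simp: merge_def)
    then show "h w * cvar k w = (\<integral>z. h (restrict (glue k w z) {1..k}) * cvar k (glue k w z) \<partial>tail k)"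
      by (simp add: restr[OF w] B.prob_space del: restrict_merge)
  qed
  also have "\<dots> = (\<integral>w. h (restrict w {1..k}) * cvar k w \<partial>?P)"
    using k by (intro integral_eq_iterated[symmetric] P.integrable_const_bound[where B=C] AE_I2)
      (auto intro!: bnd abs_cvar_le simp del: abs_mult)
  finally show ?thesis .
qed

end

section \<open>Generated sigma-algebras and independence\<close>

lemma subalgebra_gen_sigma:
  assumes "\<And>i. i \<in> I \<Longrightarrow> Y i \<in> borel_measurable M"
  shows "subalgebra M (gen_sigma M Y I)"
proof -
  have "sigma_sets (space M) {Y i -` B \<inter> space M | i B. i \<in> I \<and> B \<in> sets borel} \<subseteq> sets M"
    using assms by (intro sets.sigma_sets_subset) (auto intro: measurable_sets)
  then show ?thesis
    unfolding subalgebra_def gen_sigma_def by (subst sets_measure_of) (auto simp: space_measure_of_conv)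
qed

lemma measurable_gen_sigma:
  assumes "i \<in> I"
  shows "Y i \<in> borel_measurable (gen_sigma M Y I)"
  using assms unfolding gen_sigma_def
  by (intro measurableI) (auto simp: sets_measure_of_conv intro!: sigma_sets.Basic)

text \<open>The preimages under \<open>h\<close> form a sigma-algebra, and it contains every
  generator because each \<open>Y i\<close> factors through \<open>h\<close>. It serves to write
  events of the weights as events of the prefix of pairs.\<close>

lemma gen_sigma_sets_vimage:
  assumes A: "A \<in> sets (gen_sigma M Y I)"
    and h: "h \<in> space M \<rightarrow> space L"
    and Y: "\<And>i. i \<in> I \<Longrightarrow> \<exists>g \<in> borel_measurable L. \<forall>\<omega>\<in>space M. Y i \<omega> = g (h \<omega>)"
  obtains B where "B \<in> sets L" "A = h -` B \<inter> space M"
proof -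
  have "sigma_sets (space M) {Y i -` B \<inter> space M | i B. i \<in> I \<and> B \<in> sets borel}
      \<subseteq> sets (vimage_algebra (space M) h L)"
  proof (rule sets.sigma_sets_subset[of _ "vimage_algebra (space M) h L", simplified], safe)
    fix i and B :: "real set" assume i: "i \<in> I" and B: "B \<in> sets borel"
    from Y[OF i] obtain g where g: "g \<in> borel_measurable L" "\<forall>\<omega>\<in>space M. Y i \<omega> = g (h \<omega>)" by blast
    have "Y i -` B \<inter> space M = h -` (g -` B \<inter> space L) \<inter> space M"
      using g(2) h by auto
    also have "\<dots> \<in> sets (vimage_algebra (space M) h L)"
      using g(1) B by (intro in_vimage_algebra measurable_sets) auto
    finally show "Y i -` B \<inter> space M \<in> sets (vimage_algebra (space M) h L)" .
  qed
  moreover have "A \<in> sigma_sets (space M) {Y i -` B \<inter> space M | i B. i \<in> I \<and> B \<in> sets borel}"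
    using A unfolding gen_sigma_def by (subst (asm) sets_measure_of) auto
  ultimately have "A \<in> sets (vimage_algebra (space M) h L)" by blast
  then show ?thesis using that h by (auto simp: sets_vimage_algebra2)
qed

text \<open>Independence is phrased through bare families of preimages, as in the hypothesis on
  \<open>W'\<close>. It gives the product formula on rectangles, and these determine the product
  measure.\<close>

lemma (in prob_space) distr_Pair_eq_if_indep_set_vimage:
  assumes X [measurable]: "random_variable S X" and Y [measurable]: "random_variable T Y"
    and indep: "indep_set {X -` A \<inter> space M | A. A \<in> sets S} {Y -` B \<inter> space M | B. B \<in> sets T}"
  shows "distr M S X \<Otimes>\<^sub>M distr M T Y = distr M (S \<Otimes>\<^sub>M T) (\<lambda>\<omega>. (X \<omega>, Y \<omega>))"
proof (rule pair_measure_eqI)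
  interpret X: prob_space "distr M S X" by (rule prob_space_distr) fact
  interpret Y: prob_space "distr M T Y" by (rule prob_space_distr) fact
  show "sigma_finite_measure (distr M S X)" "sigma_finite_measure (distr M T Y)" by unfold_locales
  fix A B assume "A \<in> sets (distr M S X)" "B \<in> sets (distr M T Y)"
  then have AB [measurable]: "A \<in> sets S" "B \<in> sets T" by auto
  have "prob ((X -` A \<inter> space M) \<inter> (Y -` B \<inter> space M)) = prob (X -` A \<inter> space M) * prob (Y -` B \<inter> space M)"
    using AB by (intro indep_setD[OF indep]) auto
  moreover have "(\<lambda>\<omega>. (X \<omega>, Y \<omega>)) -` (A \<times> B) \<inter> space M = (X -` A \<inter> space M) \<inter> (Y -` B \<inter> space M)" by auto
  ultimately show "emeasure (distr M S X) A * emeasure (distr M T Y) B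
      = emeasure (distr M (S \<Otimes>\<^sub>M T) (\<lambda>\<omega>. (X \<omega>, Y \<omega>))) (A \<times> B)"
    by (simp add: emeasure_distr emeasure_eq_measure ennreal_mult)
qed simp

section \<open>Weighted averages\<close>

text \<open>Compare both averages with \<open>s = B / A\<close>, the average without the exchanged
  item. Each differs from \<open>s\<close> by its own normalized weight times \<open>r - s\<close>
  or \<open>r' - s\<close>, of modulus at most 1, and
  \<open>(u - v)\<^sup>2 \<le> 2 * (u\<^sup>2 + v\<^sup>2)\<close> combines the two.\<close>

lemma square_diff_weighted_average_le:
  fixes a a' r r' A B :: real
  assumes "A > 0" "0 \<le> B" "B \<le> A" "a > 0" "a' > 0" "0 \<le> r" "r \<le> 1" "0 \<le> r'" "r' \<le> 1"
  shows "((a * r + B) / (a + A) - (a' * r' + B) / (a' + A))\<^sup>2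
    \<le> 2 * ((a / (a + A))\<^sup>2 + (a' / (a' + A))\<^sup>2)"
proof -
  define s where "s = B / A"
  have B: "B = s * A" using assms by (simp add: s_def)
  have s: "0 \<le> s" "s \<le> 1" using assms by (simp_all add: s_def)
  have shift: "(c * p + B) / (c + A) - s = c / (c + A) * (p - s)" if "c > 0" for c p
    using that assms by (simp add: B field_simps)
  have sq: "(c * (p - s))\<^sup>2 \<le> c\<^sup>2" if "0 \<le> p" "p \<le> 1" for c p
  proof -
    have "\<bar>p - s\<bar> \<le> 1" using that s by auto
    then have "(p - s)\<^sup>2 \<le> 1" by (simp add: abs_square_le_1)
    then show ?thesis
      using mult_left_mono[of "(p - s)\<^sup>2" 1 "c\<^sup>2"] by (simp add: power_mult_distrib)
  qed
  define u v where "u = a / (a + A) * (r - s)" and "v = a' / (a' + A) * (r' - s)"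
  have "(a * r + B) / (a + A) - (a' * r' + B) / (a' + A) = u - v"
    using shift[OF \<open>a > 0\<close>, of r] shift[OF \<open>a' > 0\<close>, of r'] unfolding u_def v_def by simp
  moreover have "(u - v)\<^sup>2 \<le> 2 * (u\<^sup>2 + v\<^sup>2)"
    using zero_le_power2[of "u + v"] by (simp add: power2_eq_square algebra_simps)
  moreover have "u\<^sup>2 \<le> (a / (a + A))\<^sup>2" "v\<^sup>2 \<le> (a' / (a' + A))\<^sup>2"
    unfolding u_def v_def using assms by (intro sq; simp)+
  ultimately show ?thesis by (simp only: distrib_left)
qed

text \<open>
  Replacing nonpositive weights by 1 and clipping the rewards to the unit interval changes
  nothing on the range of the data, but makes all bounds hold at every point of the product space
  instead of almost everywhere.
\<close>

definition pos_or_one :: "real \<Rightarrow> real" where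
  "pos_or_one w = (if w > 0 then w else 1)"

definition clip01 :: "real \<Rightarrow> real" where
  "clip01 r = max 0 (min 1 r)"

lemma pos_or_one_pos [simp]: "pos_or_one w > 0"
  by (simp add: pos_or_one_def)

lemma pos_or_one_eq: "w > 0 \<Longrightarrow> pos_or_one w = w"
  by (simp add: pos_or_one_def)

lemma pos_or_one_measurable [measurable]: "pos_or_one \<in> borel_measurable borel"
  unfolding pos_or_one_def[abs_def] by measurable

lemma clip01_bounds [simp]: "0 \<le> clip01 r" "clip01 r \<le> 1"
  by (simp_all add: clip01_def)

lemma clip01_eq: "0 \<le> r \<Longrightarrow> r \<le> 1 \<Longrightarrow> clip01 r = r"
  by (simp add: clip01_def)

lemma clip01_measurable [measurable]: "clip01 \<in> borel_measurable borel"
  unfolding clip01_def[abs_def] by measurable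

definition wavg :: "nat \<Rightarrow> (nat \<Rightarrow> real \<times> real) \<Rightarrow> real" where
  "wavg n w = (\<Sum>i=1..n. pos_or_one (fst (w i)) * clip01 (snd (w i))) / (\<Sum>i=1..n. pos_or_one (fst (w i)))"

text \<open>The sum of the squares of \<open>Wt\<close> and \<open>Ut\<close> on the product space,
  with \<open>x\<close> as the independent copy of the \<open>k\<close>-th pair.\<close>

definition wsq :: "nat \<Rightarrow> nat \<Rightarrow> (nat \<Rightarrow> real \<times> real) \<Rightarrow> real \<times> real \<Rightarrow> real" where
  "wsq n k w x = (pos_or_one (fst (w k)) / (\<Sum>i=1..n. pos_or_one (fst (w i))))\<^sup>2
     + (pos_or_one (fst x) / (pos_or_one (fst x) + (\<Sum>i\<in>{1..n}-{k}. pos_or_one (fst (w i)))))\<^sup>2"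

text \<open>Rewards are never read. They can therefore be replaced by 0, which later shows that the
  conditional expectation depends on the weights alone.\<close>

lemma wsq_cong:
  assumes "\<And>i. i \<in> {1..n} \<Longrightarrow> fst (w i) = fst (w' i)" "k \<in> {1..n}"
  shows "wsq n k w x = wsq n k w' x"
proof -
  have "(\<Sum>i\<in>J. pos_or_one (fst (w i))) = (\<Sum>i\<in>J. pos_or_one (fst (w' i)))" if "J \<subseteq> {1..n}" for J
    using assms that by (intro sum.cong) auto
  then show ?thesis using assms by (simp add: wsq_def)
qed

lemma wavg_bounds:
  assumes "n \<ge> 1"
  shows "0 \<le> wavg n w" "wavg n w \<le> 1"
proof -
  have pos: "(\<Sum>i=1..n. pos_or_one (fst (w i))) > 0"
    using assms by (intro sum_pos) auto
  show "0 \<le> wavg n w"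
    unfolding wavg_def by (intro divide_nonneg_nonneg sum_nonneg) (auto simp: less_imp_le)
  have "(\<Sum>i=1..n. pos_or_one (fst (w i)) * clip01 (snd (w i))) \<le> (\<Sum>i=1..n. pos_or_one (fst (w i)))"
    by (intro sum_mono) (simp add: mult_left_le less_imp_le)
  then show "wavg n w \<le> 1" unfolding wavg_def using pos by simp
qed

lemma wsq_bounds:
  assumes k: "k \<in> {1..n}"
  shows "0 \<le> wsq n k w x" "wsq n k w x \<le> 2"
proof -
  have s: "(\<Sum>i=1..n. pos_or_one (fst (w i)))
      = pos_or_one (fst (w k)) + (\<Sum>i\<in>{1..n}-{k}. pos_or_one (fst (w i)))"
    using k by (subst sum.remove[of _ k]) auto
  have nn: "(\<Sum>i\<in>{1..n}-{k}. pos_or_one (fst (w i))) \<ge> 0"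
    by (intro sum_nonneg) (simp add: less_imp_le)
  have *: "(pos_or_one c / (pos_or_one c + A))\<^sup>2 \<le> 1" if "A \<ge> 0" for c A
    using that pos_or_one_pos[of c] by (intro power_le_one) (simp_all del: pos_or_one_pos)
  show "0 \<le> wsq n k w x" by (simp add: wsq_def)
  show "wsq n k w x \<le> 2"
    unfolding wsq_def s using *[OF nn] by (smt (verit))
qed

lemma square_diff_wavg_le:
  assumes n: "n \<ge> 2" and k: "k \<in> {1..n}"
  shows "(wavg n w - wavg n (w(k := x)))\<^sup>2 \<le> 2 * wsq n k w x"
proof -
  define A B where "A = (\<Sum>i\<in>{1..n}-{k}. pos_or_one (fst (w i)))"
    and "B = (\<Sum>i\<in>{1..n}-{k}. pos_or_one (fst (w i)) * clip01 (snd (w i)))"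
  \<comment> \<open>An index other than \<open>k\<close>, available because
    \<open>n \<ge> 2\<close>; it makes the total weight \<open>A\<close> of the others
    positive.\<close>
  have "(if k = 1 then 2 else 1) \<in> {1..n} - {k}"
    using n k by auto
  then have "{1..n} - {k} \<noteq> {}" by blast
  then have A: "A > 0" unfolding A_def by (intro sum_pos) auto
  have B: "0 \<le> B" "B \<le> A" unfolding A_def B_def
    by (intro sum_nonneg sum_mono; simp add: mult_left_le less_imp_le)+
  have sums: "(\<Sum>i=1..n. pos_or_one (fst ((w(k := v)) i))) = pos_or_one (fst v) + A"
    "(\<Sum>i=1..n. pos_or_one (fst ((w(k := v)) i)) * clip01 (snd ((w(k := v)) i)))
      = pos_or_one (fst v) * clip01 (snd v) + B" for v
    using k unfolding A_def B_def by (subst sum.remove[of _ k]; auto intro!: sum.cong)+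
  have s: "(\<Sum>i=1..n. pos_or_one (fst (w i))) = pos_or_one (fst (w k)) + A"
    using sums(1)[of "w k"] by simp
  have "wavg n (w(k := w k)) = (pos_or_one (fst (w k)) * clip01 (snd (w k)) + B) / (pos_or_one (fst (w k)) + A)"
    unfolding wavg_def sums ..
  moreover have "wavg n (w(k := x)) = (pos_or_one (fst x) * clip01 (snd x) + B) / (pos_or_one (fst x) + A)"
    unfolding wavg_def sums ..
  ultimately show ?thesis
    unfolding wsq_def s A_def[symmetric]
    using square_diff_weighted_average_le[OF A B, of "pos_or_one (fst (w k))" "pos_or_one (fst x)"
        "clip01 (snd (w k))" "clip01 (snd x)"] by simp
qed

theorem theorem6:
  fixes M :: "'a measure" and n :: nat
    and W R W' :: "nat \<Rightarrow> 'a \<Rightarrow> real"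
    and x y :: real
  assumes "prob_space M"
    and "n \<ge> 2"
    and indep: "prob_space.indep_vars M (\<lambda>_. borel) (\<lambda>i \<omega>. (W i \<omega>, R i \<omega>)) {1..n}"
    and vals: "\<And>i \<omega>. i \<in> {1..n} \<Longrightarrow> \<omega> \<in> space M \<Longrightarrow> W i \<omega> > 0 \<and> 0 \<le> R i \<omega> \<and> R i \<omega> \<le> 1"
    and W'_meas: "\<And>k. k \<in> {1..n} \<Longrightarrow> W' k \<in> borel_measurable M"
    and W'_distr: "\<And>k. k \<in> {1..n} \<Longrightarrow> distr M borel (W' k) = distr M borel (W k)"
    and W'_indep: "\<And>k. k \<in> {1..n} \<Longrightarrow>
       prob_space.indep_set M
         {W' k -` A \<inter> space M | A. A \<in> sets borel}
         {(\<lambda>\<omega>. \<lambda>i\<in>{1..n}. (W i \<omega>, R i \<omega>)) -` B \<inter> space M | B.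
            B \<in> sets (PiM {1..n} (\<lambda>_. borel :: (real \<times> real) measure))}"
    and "y > 0" and "x \<ge> 2"
  shows "measure M {\<omega> \<in> space M.
           \<bar>f_wa n W R \<omega> - prob_space.expectation M (f_wa n W R)\<bar>
             \<le> sqrt (2 * (2 * V_wa M n W W' \<omega> + y)
                      * (1 + ln (sqrt (1 + 2 * V_wa M n W W' \<omega> / y))) * x)}
         \<ge> 1 - exp (- x)"
proof -
  interpret prob_space M by fact
  note [simp del] = One_nat_def

  \<comment> \<open>Transport of the data to a product of laws\<close>
  let ?L = "PiM {1..n} (\<lambda>_. borel :: (real \<times> real) measure)"
  define X where "X i \<omega> = (W i \<omega>, R i \<omega>)" for i \<omega>
  have X_meas: "X i \<in> M \<rightarrow>\<^sub>M borel" if "i \<in> {1..n}" for i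
    using indep that unfolding indep_vars_def X_def by auto
  have W_meas [measurable]: "W i \<in> borel_measurable M" if "i \<in> {1..n}" for i
    using measurable_compose[OF X_meas[OF that], of fst borel] by (simp add: X_def borel_prod[symmetric])
  have R_meas [measurable]: "R i \<in> borel_measurable M" if "i \<in> {1..n}" for i
    using measurable_compose[OF X_meas[OF that], of snd borel] by (simp add: X_def borel_prod[symmetric])
  \<comment> \<open>The point mass outside \<open>{1..n}\<close> is a default that makes every
    \<open>N i\<close> a probability measure, as the locale demands.\<close>
  define N where "N i = (if i \<in> {1..n} then distr M borel (X i) else return borel (0, 0))" for i
  have sets_N [simp, measurable_cong]: "sets (N i) = sets borel" for i by (simp add: N_def)
  have space_N [simp]: "space (N i) = UNIV" for i by (simp add: N_def)
  have sets_P: "sets (PiM I N) = sets (PiM I (\<lambda>_. borel))" for I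
    by (intro sets_PiM_cong) auto
  have comp: "(\<lambda>w. fst (w i)) \<in> borel_measurable (PiM I N)" "(\<lambda>w. snd (w i)) \<in> borel_measurable (PiM I N)"
    if "i \<in> I" for i I
  proof -
    have "(\<lambda>w. w i) \<in> PiM I N \<rightarrow>\<^sub>M borel \<Otimes>\<^sub>M borel"
      using measurable_component_singleton[OF that, of N] unfolding borel_prod
      by (simp cong: measurable_cong_sets)
    then show "(\<lambda>w. fst (w i)) \<in> borel_measurable (PiM I N)" "(\<lambda>w. snd (w i)) \<in> borel_measurable (PiM I N)"
      by (auto intro: measurable_compose)
  qed
  have fst_N [measurable]: "fst \<in> borel_measurable (N i)" for i
    by (simp add: borel_prod[symmetric] cong: measurable_cong_sets)
  \<comment> \<open>Since \<open>wsq\<close> is at most 2, the constant 4 bounds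
    \<open>2 * wsq\<close>; it also bounds the average, which lies in the unit interval.\<close>
  interpret B: bounded_differences_product N n "wavg n" "\<lambda>k w x. 2 * wsq n k w x" 4
  proof (rule bounded_differences_product.intro)
    show "prob_space (N i)" for i
      using X_meas by (auto simp: N_def intro!: prob_space_distr prob_space_return)
    note comp[measurable]
    show "wavg n \<in> borel_measurable (PiM {1..n} N)"
      unfolding wavg_def[abs_def] by measurable
    show "(\<lambda>(w, x). 2 * wsq n k w x) \<in> borel_measurable (PiM {1..n} N \<Otimes>\<^sub>M N k)" if "k \<in> {1..n}" for k
      using that unfolding wsq_def[abs_def] by measurable
    show "\<bar>wavg n w\<bar> \<le> 4" for w
      using wavg_bounds[of n w] \<open>n \<ge> 2\<close> by simp
    show "\<bar>2 * wsq n k w x\<bar> \<le> 4" if "k \<in> {1..n}" for k w x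
      using wsq_bounds[OF that, of w x] by simp
    show "(wavg n w - wavg n (w(k := x)))\<^sup>2 \<le> 2 * wsq n k w x" if "k \<in> {1..n}" for k w x
      by (rule square_diff_wavg_le[OF \<open>n \<ge> 2\<close> that])
  qed
  let ?P = "PiM {1..n} N"
  define T where "T \<omega> = (\<lambda>i\<in>{1..n}. X i \<omega>)" for \<omega>
  \<comment> \<open>\<open>T\<close> is used with two targets: \<open>?L\<close> fits the
    independence hypotheses and \<open>?P\<close> the locale. They have the same measurable sets but
    carry different measures.\<close>
  have T_meas' [measurable]: "T \<in> M \<rightarrow>\<^sub>M ?L"
    unfolding T_def[abs_def] by (intro measurable_restrict X_meas)
  have T_meas [measurable]: "T \<in> M \<rightarrow>\<^sub>M ?P"
    using T_meas' by (simp cong: measurable_cong_sets add: sets_P)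
  have "distr M ?L T = (\<Pi>\<^sub>M i\<in>{1..n}. distr M borel (X i))"
    using indep \<open>n \<ge> 2\<close> X_meas unfolding T_def[abs_def] X_def[abs_def]
    by (subst (asm) indep_vars_iff_distr_eq_PiM') auto
  also have "\<dots> = ?P" by (intro PiM_cong) (auto simp: N_def)
  finally have distr_T': "distr M ?L T = ?P" .
  have distr_T: "distr M ?P T = ?P"
    using distr_T' by (metis distr_cong sets_P)
  have f_eq: "wavg n (T \<omega>) = f_wa n W R \<omega>" if "\<omega> \<in> space M" for \<omega>
    using vals[OF _ that] unfolding wavg_def f_wa_def
    by (intro arg_cong2[where f="(/)"] sum.cong) (auto simp: T_def X_def pos_or_one_eq clip01_eq)
  have mean_eq: "B.mean = expectation (f_wa n W R)"
  proof -
    have "B.mean = integral\<^sup>L (distr M ?P T) (wavg n)" by (simp only: distr_T)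
    also have "\<dots> = expectation (\<lambda>\<omega>. wavg n (T \<omega>))" by (rule integral_distr) measurable
    also have "\<dots> = expectation (f_wa n W R)" by (intro Bochner_Integration.integral_cong f_eq) auto
    finally show ?thesis .
  qed

  \<comment> \<open>Conditional expectations of the squared weights\<close>
  have cond: "AE \<omega> in M. real_cond_exp M (gen_sigma M W {1..k})
       (\<lambda>\<xi>. (Wt n W k \<xi>)\<^sup>2 + (Ut n W W' k \<xi>)\<^sup>2) \<omega> = B.cvar k (T \<omega>) / 2" if k: "k \<in> {1..n}" for k
  proof -
    let ?F = "gen_sigma M W {1..k}"
    \<comment> \<open>The reward 0 is a placeholder: \<open>wsq\<close> reads only the weight of its
      last argument.\<close>
    let ?g = "\<lambda>\<omega>. wsq n k (T \<omega>) (W' k \<omega>, 0)"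
    note [measurable] = W'_meas[OF k] W_meas[OF k]
    have sub: "subalgebra M ?F" using k by (intro subalgebra_gen_sigma W_meas) auto
    interpret F: finite_measure_subalgebra M ?F by standard (rule sub)
    have wsq_meas: "case_prod (wsq n k) \<in> borel_measurable (?P \<Otimes>\<^sub>M N k)"
      using k comp unfolding wsq_def[abs_def] by measurable
    have pair_meas: "(\<lambda>p. wsq n k (snd p) (fst p, 0)) \<in> borel_measurable (borel \<Otimes>\<^sub>M ?P)"
    proof -
      have "(\<lambda>p :: real \<times> (nat \<Rightarrow> real \<times> real). (snd p, (fst p, 0 :: real))) \<in> borel \<Otimes>\<^sub>M ?P \<rightarrow>\<^sub>M ?P \<Otimes>\<^sub>M (borel \<Otimes>\<^sub>M borel)"
        by measurable
      then have "(\<lambda>p :: real \<times> (nat \<Rightarrow> real \<times> real). (snd p, (fst p, 0 :: real))) \<in> borel \<Otimes>\<^sub>M ?P \<rightarrow>\<^sub>M ?P \<Otimes>\<^sub>M N k"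
        by (simp add: borel_prod cong: measurable_cong_sets sets_pair_measure_cong)
      from measurable_compose[OF this wsq_meas] show ?thesis by simp
    qed
    have g_meas [measurable]: "?g \<in> borel_measurable M"
      using measurable_compose[OF _ pair_meas, of "\<lambda>\<omega>. (W' k \<omega>, T \<omega>)" M] by simp
    \<comment> \<open>Only the law of \<open>W' k\<close> is known, so positivity passes from
      \<open>W k\<close> to it merely almost surely. That suffices for conditional
      expectations.\<close>
    have W'_pos: "AE \<omega> in M. W' k \<omega> > 0"
    proof -
      have "AE u in distr M borel (W k). u > 0"
        using vals[OF k] by (subst AE_distr_iff) auto
      then have "AE u in distr M borel (W' k). u > 0" by (simp only: W'_distr[OF k])
      then show ?thesis by (subst (asm) AE_distr_iff) auto
    qed
    have [measurable]: "Wt n W k \<in> borel_measurable M" "Ut n W W' k \<in> borel_measurable M"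
      unfolding Wt_def[abs_def] Ut_def[abs_def] by (measurable; simp)+
    have "AE \<omega> in M. (Wt n W k \<omega>)\<^sup>2 + (Ut n W W' k \<omega>)\<^sup>2 = ?g \<omega>"
      using W'_pos AE_space
    proof eventually_elim
      case (elim \<omega>)
      have "pos_or_one (fst (T \<omega> i)) = W i \<omega>" if "i \<in> {1..n}" for i
        using vals[OF that elim(2)] that by (simp add: T_def X_def pos_or_one_eq)
      then show ?case
        using k elim(1) by (simp add: wsq_def Wt_def Ut_def pos_or_one_eq)
    qed
    then have "AE \<omega> in M. real_cond_exp M ?F (\<lambda>\<xi>. (Wt n W k \<xi>)\<^sup>2 + (Ut n W W' k \<xi>)\<^sup>2) \<omega> = real_cond_exp M ?F ?g \<omega>"
      by (intro F.real_cond_exp_cong) auto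
    moreover have "AE \<omega> in M. real_cond_exp M ?F ?g \<omega> = B.cvar k (T \<omega>) / 2"
    \<comment> \<open>What has to be checked is measurability in the weights and equality of the
      integrals over every event of \<open>?F\<close>.\<close>
    proof (rule F.real_cond_exp_charact)
      have [measurable]: "B.cvar k \<in> borel_measurable ?P" using k by (intro B.borel_measurable_cvar) auto
      have T_space: "T \<omega> \<in> space ?P" for \<omega> by (auto simp: T_def space_PiM)
      show "integrable M ?g"
        using wsq_bounds[OF k] by (intro integrable_const_bound[where B=2] AE_I2) auto
      show "integrable M (\<lambda>\<omega>. B.cvar k (T \<omega>) / 2)"
        using B.abs_cvar_le[OF _ k T_space] k by (intro integrable_const_bound[where B=2] AE_I2) auto
      show "(\<lambda>\<omega>. B.cvar k (T \<omega>) / 2) \<in> borel_measurable ?F"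
      proof -
        have "(\<lambda>\<omega>. (W i \<omega>, 0 :: real)) \<in> ?F \<rightarrow>\<^sub>M borel" if "i \<in> {1..k}" for i
          using measurable_gen_sigma[OF that, of W M] unfolding borel_prod[symmetric] by measurable
        then have "(\<lambda>\<omega>. \<lambda>i\<in>{1..k}. (W i \<omega>, 0)) \<in> ?F \<rightarrow>\<^sub>M PiM {1..k} N"
          by (intro measurable_restrict) (simp cong: measurable_cong_sets)
        from measurable_compose[OF this B.borel_measurable_cvar[OF order_refl k]]
        have "(\<lambda>\<omega>. B.cvar k (\<lambda>i\<in>{1..k}. (W i \<omega>, 0))) \<in> borel_measurable ?F" .
        \<comment> \<open>Erasing the rewards of the prefix leaves \<open>cvar\<close> unchanged, so
          it is a measurable function of the first \<open>k\<close> weights.\<close>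
        moreover have "B.cvar k (T \<omega>) = B.cvar k (\<lambda>i\<in>{1..k}. (W i \<omega>, 0))" for \<omega>
        proof -
          have "fst (B.glue k (T \<omega>) z i) = fst (B.glue k (\<lambda>i\<in>{1..k}. (W i \<omega>, 0)) z i)" if "i \<in> {1..n}" for i z
            using that k by (auto simp: merge_def T_def X_def)
          then have "wsq n k (B.glue k (T \<omega>) z) x = wsq n k (B.glue k (\<lambda>i\<in>{1..k}. (W i \<omega>, 0)) z) x" for z x
            using k by (intro wsq_cong)
          then show ?thesis by (simp only: B.cvar_def)
        qed
        ultimately show ?thesis by simp
      qed
      fix A assume A: "A \<in> sets ?F"
      \<comment> \<open>An event of the weights is in particular an event of the first
        \<open>k\<close> pairs. Its indicator becomes the test function \<open>?h\<close> for
        \<open>integral_prefix_cvar\<close>.\<close>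
      obtain D where D: "D \<in> sets (PiM {1..k} N)" "A = (\<lambda>\<omega>. restrict (T \<omega>) {1..k}) -` D \<inter> space M"
      proof (rule gen_sigma_sets_vimage[OF A])
        show "(\<lambda>\<omega>. restrict (T \<omega>) {1..k}) \<in> space M \<rightarrow> space (PiM {1..k} N)"
          by (auto simp: space_PiM)
        show "\<exists>g\<in>borel_measurable (PiM {1..k} N). \<forall>\<omega>\<in>space M. W i \<omega> = g (restrict (T \<omega>) {1..k})"
          if "i \<in> {1..k}" for i
          using that k comp(1)[OF that] by (intro bexI[of _ "\<lambda>w. fst (w i)"]) (auto simp: T_def X_def)
      qed
      let ?h = "indicator D :: _ \<Rightarrow> real"
      have h_meas: "?h \<in> borel_measurable (PiM {1..k} N)" using D by simp
      have [measurable]: "(\<lambda>w. ?h (restrict w {1..k})) \<in> borel_measurable ?P"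
        using k by (intro measurable_compose[OF _ h_meas] measurable_restrict_subset) auto
      have ind: "indicator A \<omega> = ?h (restrict (T \<omega>) {1..k})" if "\<omega> \<in> space M" for \<omega>
        using that D(2) by (auto simp: indicator_def)
      \<comment> \<open>\<open>W' k\<close> is independent of the whole sample and has the law of
        \<open>W k\<close>, so the joint law is a product.\<close>
      have joint: "distr M borel (W k) \<Otimes>\<^sub>M ?P = distr M (borel \<Otimes>\<^sub>M ?P) (\<lambda>\<omega>. (W' k \<omega>, T \<omega>))"
      proof -
        have "distr M borel (W' k) \<Otimes>\<^sub>M distr M ?L T = distr M (borel \<Otimes>\<^sub>M ?L) (\<lambda>\<omega>. (W' k \<omega>, T \<omega>))"
          using W'_indep[OF k] unfolding T_def[abs_def] X_def
          by (intro distr_Pair_eq_if_indep_set_vimage W'_meas[OF k] T_meas'[unfolded T_def[abs_def] X_def])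
        then have "distr M borel (W k) \<Otimes>\<^sub>M ?P = distr M (borel \<Otimes>\<^sub>M ?L) (\<lambda>\<omega>. (W' k \<omega>, T \<omega>))"
          by (simp add: W'_distr[OF k] distr_T')
        also have "\<dots> = distr M (borel \<Otimes>\<^sub>M ?P) (\<lambda>\<omega>. (W' k \<omega>, T \<omega>))"
          by (intro distr_cong sets_pair_measure_cong) (auto simp: sets_P)
        finally show ?thesis .
      qed
      interpret D: prob_space "distr M borel (W k)" by (rule prob_space_distr) measurable
      interpret P: prob_space ?P by (rule B.prob_space_PiM_N)
      interpret DP: pair_prob_space "distr M borel (W k)" ?P ..
      have G_meas [measurable]: "(\<lambda>p. ?h (restrict (snd p) {1..k}) * wsq n k (snd p) (fst p, 0)) \<in> borel_measurable (borel \<Otimes>\<^sub>M ?P)"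
        using pair_meas by measurable
      have G_int: "integrable (distr M borel (W k) \<Otimes>\<^sub>M ?P) (\<lambda>(u, w). ?h (restrict w {1..k}) * wsq n k w (u, 0))"
      proof (intro DP.integrable_const_bound[where B=2] AE_I2)
        show "(\<lambda>(u, w). ?h (restrict w {1..k}) * wsq n k w (u, 0)) \<in> borel_measurable (distr M borel (W k) \<Otimes>\<^sub>M ?P)"
          using G_meas by (simp add: split_beta' cong: measurable_cong_sets sets_pair_measure_cong)
        show "norm (case p of (u, w) \<Rightarrow> ?h (restrict w {1..k}) * wsq n k w (u, 0)) \<le> 2" for p
          using wsq_bounds[OF k, of "snd p" "(fst p, 0)"] by (auto simp: split_beta' indicator_def)
      qed
      have "(\<integral>\<omega>\<in>A. ?g \<omega> \<partial>M) = (\<integral>\<omega>. ?h (restrict (T \<omega>) {1..k}) * wsq n k (T \<omega>) (W' k \<omega>, 0) \<partial>M)"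
        unfolding set_lebesgue_integral_def by (intro Bochner_Integration.integral_cong) (auto simp: ind)
      also have "\<dots> = (\<integral>(u, w). ?h (restrict w {1..k}) * wsq n k w (u, 0) \<partial>(distr M borel (W k) \<Otimes>\<^sub>M ?P))"
        unfolding joint by (subst integral_distr) (use G_meas in \<open>auto simp: split_beta'\<close>)
      also have "\<dots> = (\<integral>w. (\<integral>u. ?h (restrict w {1..k}) * wsq n k w (u, 0) \<partial>distr M borel (W k)) \<partial>?P)"
        by (rule DP.integral_snd[symmetric, OF G_int])
      also have "\<dots> = (\<integral>w. ?h (restrict w {1..k}) * (\<integral>x. 2 * wsq n k w x \<partial>N k) \<partial>?P) / 2"
      proof -
        \<comment> \<open>The law of \<open>W k\<close> is the image of \<open>N k\<close> under
          \<open>fst\<close>, so drawing a fresh weight or a fresh pair gives the same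
          integral.\<close>
        have "(\<integral>u. wsq n k w (u, 0) \<partial>distr M borel (W k)) = (\<integral>x. wsq n k w x \<partial>N k)" if "w \<in> space ?P" for w
        proof -
          have "distr M borel (W k) = distr (N k) borel fst"
            using k X_meas[OF k] by (simp add: N_def distr_distr borel_prod[symmetric] comp_def X_def)
          moreover have "(\<lambda>u. wsq n k w (u, 0)) \<in> borel_measurable borel"
            unfolding wsq_def by measurable
          ultimately have "(\<integral>u. wsq n k w (u, 0) \<partial>distr M borel (W k)) = (\<integral>x. wsq n k w (fst x, 0) \<partial>N k)"
            by (simp add: integral_distr)
          then show ?thesis by (simp add: wsq_def)
        qed
        then show ?thesis
          by (subst Bochner_Integration.integral_divide_zero[symmetric])
             (auto intro!: Bochner_Integration.integral_cong)
      qed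
      also have "\<dots> = (\<integral>w. ?h (restrict w {1..k}) * B.cvar k w \<partial>?P) / 2"
        by (subst B.integral_prefix_cvar[OF k h_meas]) (auto simp: indicator_def)
      also have "\<dots> = (\<integral>w. ?h (restrict w {1..k}) * B.cvar k w \<partial>distr M ?P T) / 2" by (simp only: distr_T)
      also have "\<dots> = (\<integral>\<omega>. ?h (restrict (T \<omega>) {1..k}) * B.cvar k (T \<omega>) \<partial>M) / 2"
        by (subst integral_distr) auto
      also have "\<dots> = (\<integral>\<omega>\<in>A. B.cvar k (T \<omega>) / 2 \<partial>M)"
        unfolding set_lebesgue_integral_def Bochner_Integration.integral_divide_zero[symmetric]
        by (intro Bochner_Integration.integral_cong) (auto simp: ind)
      finally show "(\<integral>\<omega>\<in>A. ?g \<omega> \<partial>M) = (\<integral>\<omega>\<in>A. B.cvar k (T \<omega>) / 2 \<partial>M)" .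
    qed
    ultimately show ?thesis by eventually_elim simp
  qed

  \<comment> \<open>Transfer of the deviation bound to the original space\<close>
  have "AE \<omega> in M. \<forall>k\<in>{1..n}. real_cond_exp M (gen_sigma M W {1..k})
       (\<lambda>\<xi>. (Wt n W k \<xi>)\<^sup>2 + (Ut n W W' k \<xi>)\<^sup>2) \<omega> = B.cvar k (T \<omega>) / 2"
    using cond by (intro AE_finite_allI) auto
  then have V_eq: "AE \<omega> in M. 2 * V_wa M n W W' \<omega> = B.total_cvar (T \<omega>)"
  proof eventually_elim
    case (elim \<omega>)
    then show ?case
      unfolding V_wa_def B.total_cvar_def sum_distrib_left by (intro sum.cong) (auto simp: mult.commute)
  qed
  let ?b = "\<lambda>v. sqrt (2 * (v + y) * (1 + ln (sqrt (1 + v / y))) * x)"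
  have [measurable]: "f_wa n W R \<in> borel_measurable M" "V_wa M n W W' \<in> borel_measurable M"
    unfolding f_wa_def[abs_def] V_wa_def[abs_def] by measurable
  let ?G = "{w \<in> space ?P. \<bar>wavg n w - B.mean\<bar> \<le> ?b (B.total_cvar w)}"
  have "1 - exp (- x) \<le> measure ?P ?G"
    using B.prob_deviation_ge[of y x] \<open>y > 0\<close> \<open>x \<ge> 2\<close> by simp
  also have "\<dots> = measure (distr M ?P T) ?G" by (simp only: distr_T)
  also have "\<dots> = measure M (T -` ?G \<inter> space M)"
    by (rule measure_distr) measurable
  \<comment> \<open>\<open>V_wa\<close> is built from versions of conditional expectations and
    matches \<open>total_cvar\<close> only almost everywhere, so the two events agree up to a null
    set.\<close>
  also have "\<dots> = measure M {\<omega> \<in> space M. \<bar>f_wa n W R \<omega> - expectation (f_wa n W R)\<bar> \<le> ?b (2 * V_wa M n W W' \<omega>)}"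
  proof (rule measure_eq_AE)
    show "AE \<omega> in M. \<omega> \<in> T -` ?G \<inter> space M \<longleftrightarrow>
       \<omega> \<in> {\<omega> \<in> space M. \<bar>f_wa n W R \<omega> - expectation (f_wa n W R)\<bar> \<le> ?b (2 * V_wa M n W W' \<omega>)}"
      using V_eq AE_space
    proof eventually_elim
      case (elim \<omega>)
      have "T \<omega> \<in> space ?P" by (auto simp: T_def space_PiM)
      then show ?case by (simp add: f_eq[OF elim(2)] mean_eq elim(2) flip: elim(1))
    qed
  qed measurable
  finally show ?thesis .
qed

end
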